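(* Let $R$ be a commutative ring. If $M$ is a maximal ideal of $R$, then there is a factorization $R\to R\{X\}\to R/\!\!/M$ of the canonical ring morphism $R\to R/\!\!/M$ through the canonical ring morphism $R\to R\{X\}$. Moreover, $R\to R\{X\}$ is faithfully flat.
   Context: All rings are commutative, unital and nonzero. $X$ is an indeterminate over $R$. Let $T_1$ be the set of all maximal ideals $N$ of $R[X]$ such that $N\cap R$ is a maximal ideal of $R$, and let $\Sigma:=R[X]\setminus\bigcup_{N\in T_1}N$, a multiplicatively closed subset of $R[X]$. Then $R\{X\}:=R[X]_\Sigma$ (localization of $R[X]$ at $\Sigma$). For an ideal $I$ of $R$, $R/\!\!/I:=R[X]/XI[X]$, where $I[X]$ is the ideal of polynomials with coefficients in $I$. The canonical morphisms are $R\to R[X]\to R\{X\}$ and $R\to R[X]\to R/\!\!/M$. *)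

theory Defs
  imports "HOL-Algebra.Algebra"
begin

section \<open>Localization of a commutative ring at a multiplicatively closed subset\<close>

definition loc_rel :: "('a, 'm) ring_scheme \<Rightarrow> 'a set \<Rightarrow> (('a \<times> 'a) \<times> ('a \<times> 'a)) set"
  where "loc_rel A S =
    {((a, s), (b, t)) | a s b t. a \<in> carrier A \<and> b \<in> carrier A \<and> s \<in> S \<and> t \<in> S \<and>
      (\<exists>u\<in>S. u \<otimes>\<^bsub>A\<^esub> (t \<otimes>\<^bsub>A\<^esub> a) = u \<otimes>\<^bsub>A\<^esub> (s \<otimes>\<^bsub>A\<^esub> b))}"

definition loc_frac :: "('a, 'm) ring_scheme \<Rightarrow> 'a set \<Rightarrow> 'a \<Rightarrow> 'a \<Rightarrow> ('a \<times> 'a) set"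
  where "loc_frac A S a s = loc_rel A S `` {(a, s)}"

text \<open>The operations on classes are unions over representatives, all of which give the same
  class (cf. \<open>UN_equiv_class2\<close>).\<close>

definition localization :: "('a, 'm) ring_scheme \<Rightarrow> 'a set \<Rightarrow> ('a \<times> 'a) set ring"
  where "localization A S = \<lparr>
    carrier = (carrier A \<times> S) // loc_rel A S,
    monoid.mult = (\<lambda>p q. \<Union>(a, s)\<in>p. \<Union>(b, t)\<in>q. loc_frac A S (a \<otimes>\<^bsub>A\<^esub> b) (s \<otimes>\<^bsub>A\<^esub> t)),
    one = loc_frac A S \<one>\<^bsub>A\<^esub> \<one>\<^bsub>A\<^esub>,
    ring.zero = loc_frac A S \<zero>\<^bsub>A\<^esub> \<one>\<^bsub>A\<^esub>,
    add = (\<lambda>p q. \<Union>(a, s)\<in>p. \<Union>(b, t)\<in>q.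
      loc_frac A S ((t \<otimes>\<^bsub>A\<^esub> a) \<oplus>\<^bsub>A\<^esub> (s \<otimes>\<^bsub>A\<^esub> b)) (s \<otimes>\<^bsub>A\<^esub> t))\<rparr>"

definition loc_map :: "('a, 'm) ring_scheme \<Rightarrow> 'a set \<Rightarrow> 'a \<Rightarrow> ('a \<times> 'a) set"
  where "loc_map A S a = loc_frac A S a \<one>\<^bsub>A\<^esub>"


section \<open>The rings \<open>R{X}\<close> and \<open>R//I\<close>\<close>

definition const_poly :: "('a, 'm) ring_scheme \<Rightarrow> 'a \<Rightarrow> (nat \<Rightarrow> 'a)"
  where "const_poly R a = monom (UP R) a 0"

definition poly_contraction :: "('a, 'm) ring_scheme \<Rightarrow> (nat \<Rightarrow> 'a) set \<Rightarrow> 'a set"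
  where "poly_contraction R N = {a \<in> carrier R. const_poly R a \<in> N}"

definition T1 :: "('a, 'm) ring_scheme \<Rightarrow> (nat \<Rightarrow> 'a) set set"
  where "T1 R = {N. maximalideal N (UP R) \<and> maximalideal (poly_contraction R N) R}"

definition Sigma_T1 :: "('a, 'm) ring_scheme \<Rightarrow> (nat \<Rightarrow> 'a) set"
  where "Sigma_T1 R = carrier (UP R) - \<Union> (T1 R)"

definition brace_ring :: "('a, 'm) ring_scheme \<Rightarrow> ((nat \<Rightarrow> 'a) \<times> (nat \<Rightarrow> 'a)) set ring"
  where "brace_ring R = localization (UP R) (Sigma_T1 R)"

definition to_brace :: "('a, 'm) ring_scheme \<Rightarrow> 'a \<Rightarrow> ((nat \<Rightarrow> 'a) \<times> (nat \<Rightarrow> 'a)) set"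
  where "to_brace R = loc_map (UP R) (Sigma_T1 R) \<circ> const_poly R"

definition poly_ideal :: "('a, 'm) ring_scheme \<Rightarrow> 'a set \<Rightarrow> (nat \<Rightarrow> 'a) set"
  where "poly_ideal R I = {p \<in> carrier (UP R). \<forall>n. coeff (UP R) p n \<in> I}"

definition X_poly_ideal :: "('a, 'm) ring_scheme \<Rightarrow> 'a set \<Rightarrow> (nat \<Rightarrow> 'a) set"
  where "X_poly_ideal R I = (\<lambda>p. monom (UP R) \<one>\<^bsub>R\<^esub> 1 \<otimes>\<^bsub>UP R\<^esub> p) ` poly_ideal R I"

definition slash_ring :: "('a, 'm) ring_scheme \<Rightarrow> 'a set \<Rightarrow> (nat \<Rightarrow> 'a) set ring"
  where "slash_ring R I = UP R Quot X_poly_ideal R I"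

definition to_slash :: "('a, 'm) ring_scheme \<Rightarrow> 'a set \<Rightarrow> 'a \<Rightarrow> (nat \<Rightarrow> 'a) set"
  where "to_slash R I = (\<lambda>p. X_poly_ideal R I +>\<^bsub>UP R\<^esub> p) \<circ> const_poly R"


section \<open>Tensor products of modules\<close>

definition linear_maps ::
  "('r, 'k) ring_scheme \<Rightarrow> ('r, 'a, 'm) module_scheme \<Rightarrow> ('r, 'b, 'n) module_scheme \<Rightarrow> ('a \<Rightarrow> 'b) set"
  where "linear_maps R M N =
    {f \<in> carrier M \<rightarrow> carrier N.
      (\<forall>x\<in>carrier M. \<forall>y\<in>carrier M. f (x \<oplus>\<^bsub>M\<^esub> y) = f x \<oplus>\<^bsub>N\<^esub> f y) \<and>
      (\<forall>r\<in>carrier R. \<forall>x\<in>carrier M. f (r \<odot>\<^bsub>M\<^esub> x) = r \<odot>\<^bsub>N\<^esub> f x)}"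

definition tensor_relators ::
  "('r, 'k) ring_scheme \<Rightarrow> ('r, 'a, 'm) module_scheme \<Rightarrow> ('r, 'b, 'n) module_scheme
    \<Rightarrow> (('a \<times> 'b) \<Rightarrow>\<^sub>0 int) set"
  where "tensor_relators R M N =
    {frag_of (x \<oplus>\<^bsub>M\<^esub> x', y) - frag_of (x, y) - frag_of (x', y) | x x' y.
      x \<in> carrier M \<and> x' \<in> carrier M \<and> y \<in> carrier N} \<union>
    {frag_of (x, y \<oplus>\<^bsub>N\<^esub> y') - frag_of (x, y) - frag_of (x, y') | x y y'.
      x \<in> carrier M \<and> y \<in> carrier N \<and> y' \<in> carrier N} \<union>
    {frag_of (r \<odot>\<^bsub>M\<^esub> x, y) - frag_of (x, r \<odot>\<^bsub>N\<^esub> y) | r x y.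
      r \<in> carrier R \<and> x \<in> carrier M \<and> y \<in> carrier N}"

definition tensor_subgroup ::
  "('r, 'k) ring_scheme \<Rightarrow> ('r, 'a, 'm) module_scheme \<Rightarrow> ('r, 'b, 'n) module_scheme
    \<Rightarrow> (('a \<times> 'b) \<Rightarrow>\<^sub>0 int) set"
  where "tensor_subgroup R M N =
    generate (free_Abelian_group (carrier M \<times> carrier N)) (tensor_relators R M N)"

text \<open>The underlying abelian group of the tensor product of \<open>M\<close> and \<open>N\<close> over \<open>R\<close>, written
  multiplicatively because \<open>free_Abelian_group\<close> is. The scalar action on it is not needed, since
  exactness only concerns images and kernels.\<close>

definition tensor_product ::
  "('r, 'k) ring_scheme \<Rightarrow> ('r, 'a, 'm) module_scheme \<Rightarrow> ('r, 'b, 'n) module_scheme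
    \<Rightarrow> (('a \<times> 'b) \<Rightarrow>\<^sub>0 int) set monoid"
  where "tensor_product R M N =
    free_Abelian_group (carrier M \<times> carrier N) Mod tensor_subgroup R M N"

text \<open>The map induced by \<open>f : N \<rightarrow> N'\<close> on tensor products, sending the class of a pair \<open>(x, y)\<close>
  to the class of \<open>(x, f y)\<close>. For linear \<open>f\<close> the set given to \<open>the_elem\<close> is a singleton.\<close>

definition tensor_map ::
  "('r, 'k) ring_scheme \<Rightarrow> ('r, 'a, 'm) module_scheme \<Rightarrow> ('r, 'c, 'p) module_scheme
    \<Rightarrow> ('b \<Rightarrow> 'c) \<Rightarrow> (('a \<times> 'b) \<Rightarrow>\<^sub>0 int) set \<Rightarrow> (('a \<times> 'c) \<Rightarrow>\<^sub>0 int) set"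
  where "tensor_map R M N' f C =
    the_elem ((\<lambda>c. tensor_subgroup R M N' #>\<^bsub>free_Abelian_group (carrier M \<times> carrier N')\<^esub>
      frag_extend (\<lambda>(x, y). frag_of (x, f y)) c) ` C)"


section \<open>Faithful flatness\<close>

text \<open>\<open>M\<close> is faithfully flat over \<open>R\<close> iff a sequence \<open>N1 \<rightarrow> N2 \<rightarrow> N3\<close> of \<open>R\<close>-modules is exact
  exactly when the sequence obtained by tensoring it with \<open>M\<close> is.

  HOL cannot quantify over types inside a definition, so the carrier types of the test modules
  are parameters; a theorem that leaves them as type variables covers all modules.\<close>

definition faithfully_flat_module ::
  "'n1 itself \<Rightarrow> 'n2 itself \<Rightarrow> 'n3 itself \<Rightarrow>
    ('r, 'k) ring_scheme \<Rightarrow> ('r, 'a, 'm) module_scheme \<Rightarrow> bool"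
  where "faithfully_flat_module _ _ _ R M \<longleftrightarrow> module R M \<and>
    (\<forall>(N1 :: ('r, 'n1) module) (N2 :: ('r, 'n2) module) (N3 :: ('r, 'n3) module) f g.
      module R N1 \<longrightarrow> module R N2 \<longrightarrow> module R N3 \<longrightarrow>
      f \<in> linear_maps R N1 N2 \<longrightarrow> g \<in> linear_maps R N2 N3 \<longrightarrow>
      (f ` carrier N1 = a_kernel N2 N3 g \<longleftrightarrow>
       tensor_map R M N2 f ` carrier (tensor_product R M N1) =
         kernel (tensor_product R M N2) (tensor_product R M N3) (tensor_map R M N3 g)))"

definition module_via ::
  "('r \<Rightarrow> 'a) \<Rightarrow> ('a, 'm) ring_scheme \<Rightarrow> ('r, 'a) module"
  where "module_via h S =
    \<lparr>carrier = carrier S, monoid.mult = monoid.mult S, one = one S, ring.zero = ring.zero S, add = add S,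
     smult = (\<lambda>r s. h r \<otimes>\<^bsub>S\<^esub> s)\<rparr>"

definition faithfully_flat_hom ::
  "'n1 itself \<Rightarrow> 'n2 itself \<Rightarrow> 'n3 itself \<Rightarrow>
    ('r, 'k) ring_scheme \<Rightarrow> ('a, 'm) ring_scheme \<Rightarrow> ('r \<Rightarrow> 'a) \<Rightarrow> bool"
  where "faithfully_flat_hom t1 t2 t3 R S h \<longleftrightarrow>
    h \<in> ring_hom R S \<and> faithfully_flat_module t1 t2 t3 R (module_via h S)"

end

theory Submission
  imports Defs
begin

text \<open>
  A polynomial lies outside all \<open>N \<in> T\<^sub>1\<close> iff it is a unit modulo \<open>M[X]\<close> for every maximal ideal
  \<open>M\<close> of \<open>R\<close>. As \<open>R/M\<close> is a field, its constant coefficient is then a unit of \<open>R\<close> and its other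
  coefficients lie in every \<open>M\<close>, so it agrees with a unit of \<open>R\<close> modulo \<open>XM[X]\<close>. The universal
  property of the localization gives \<open>R{X} \<rightarrow> R//M\<close>.

  Such a polynomial is also invertible modulo every \<open>X^n\<close>. Hence elements of \<open>R{X}\<close> have power series
  coefficients, which are \<open>R\<close>-linear. If a finite set \<open>K\<close> of fractions has the common denominator \<open>s\<close>,
  then every \<open>x \<in> K\<close> is the finite sum of \<open>c\<^sub>i(s x) (X^i / s)\<close>, where \<open>c\<^sub>i\<close> takes the \<open>i\<close>-th coefficient.
  A module with such dual systems is flat: an element \<open>z\<close> of \<open>S \<otimes> N\<close> is the sum of \<open>b\<^sub>i \<otimes> (l\<^sub>i \<otimes> 1)(z)\<close>,
  and the elements \<open>(l\<^sub>i \<otimes> 1)(z)\<close> of \<open>N\<close> depend naturally on \<open>N\<close>. It is faithfully flat because \<open>c\<^sub>0\<close> is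
  a retraction of \<open>R \<rightarrow> R{X}\<close>.
\<close>

section \<open>Localization\<close>

text \<open>Collects exactly what the definitions of \<open>loc_rel\<close> and
  \<open>localization\<close> need to yield a ring; later instantiated with \<open>R[X]\<close> and
  \<open>Sigma_T1 R\<close>.\<close>

locale mult_submonoid = cring A for A (structure) +
  fixes S
  assumes S_subset: "S \<subseteq> carrier A" and one_S: "\<one> \<in> S"
    and mult_S: "\<lbrakk>s \<in> S; t \<in> S\<rbrakk> \<Longrightarrow> s \<otimes> t \<in> S"
begin

lemma S_closed [simp, intro]: "s \<in> S \<Longrightarrow> s \<in> carrier A"
  using S_subset by blast

lemma loc_relI:
  assumes "a \<in> carrier A" "b \<in> carrier A" "s \<in> S" "t \<in> S" "u \<in> S"
    and "u \<otimes> (t \<otimes> a) = u \<otimes> (s \<otimes> b)"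
  shows "((a, s), (b, t)) \<in> loc_rel A S"
  unfolding loc_rel_def using assms by blast

lemma equiv_loc_rel: "equiv (carrier A \<times> S) (loc_rel A S)"
proof (rule equivI)
  show "loc_rel A S \<subseteq> (carrier A \<times> S) \<times> (carrier A \<times> S)"
    by (auto simp: loc_rel_def)
  show "refl_on (carrier A \<times> S) (loc_rel A S)"
    using one_S by (auto simp: refl_on_def loc_rel_def)
  show "sym (loc_rel A S)"
  proof (rule symI)
    fix x y assume "(x, y) \<in> loc_rel A S"
    then obtain a s b t u where "x = (a, s)" "y = (b, t)" "a \<in> carrier A" "b \<in> carrier A"
      "s \<in> S" "t \<in> S" "u \<in> S" and "u \<otimes> (t \<otimes> a) = u \<otimes> (s \<otimes> b)"
      unfolding loc_rel_def by blast
    moreover from this have "u \<otimes> (s \<otimes> b) = u \<otimes> (t \<otimes> a)" by simp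
    ultimately show "(y, x) \<in> loc_rel A S"
      using loc_relI by simp
  qed
  show "trans (loc_rel A S)"
  proof (rule transI)
    fix x y z assume "(x, y) \<in> loc_rel A S" "(y, z) \<in> loc_rel A S"
    then obtain a s b t c r u v where eq: "x = (a, s)" "y = (b, t)" "z = (c, r)"
      and cl: "a \<in> carrier A" "b \<in> carrier A" "c \<in> carrier A"
        "s \<in> S" "t \<in> S" "r \<in> S" "u \<in> S" "v \<in> S"
      and u: "u \<otimes> (t \<otimes> a) = u \<otimes> (s \<otimes> b)" and v: "v \<otimes> (r \<otimes> b) = v \<otimes> (t \<otimes> c)"
      unfolding loc_rel_def by blast
    \<comment> \<open>The multiplier contains the middle denominator \<open>t\<close> because
      \<open>t\<close> need not be cancellable.\<close>
    have "(u \<otimes> v \<otimes> t) \<otimes> (r \<otimes> a) = (v \<otimes> r) \<otimes> (u \<otimes> (t \<otimes> a))"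
      using cl by (simp add: m_ac)
    also have "\<dots> = (u \<otimes> s) \<otimes> (v \<otimes> (r \<otimes> b))"
      unfolding u using cl by (simp add: m_ac)
    also have "\<dots> = (u \<otimes> v \<otimes> t) \<otimes> (s \<otimes> c)"
      unfolding v using cl by (simp add: m_ac)
    finally show "(x, z) \<in> loc_rel A S"
      unfolding eq by (intro loc_relI[where u = "u \<otimes> v \<otimes> t"] mult_S cl)
  qed
qed

section \<open>Fractions and their ring operations\<close>

abbreviation frac where "frac \<equiv> loc_frac A S"
abbreviation L where "L \<equiv> localization A S"

lemma frac_eq_iff:
  assumes "a \<in> carrier A" "b \<in> carrier A" "s \<in> S" "t \<in> S"
  shows "frac a s = frac b t \<longleftrightarrow> (\<exists>u\<in>S. u \<otimes> (t \<otimes> a) = u \<otimes> (s \<otimes> b))"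
proof -
  have "frac a s = frac b t \<longleftrightarrow> ((a, s), (b, t)) \<in> loc_rel A S"
    unfolding loc_frac_def using eq_equiv_class_iff[OF equiv_loc_rel] assms by blast
  then show ?thesis
    using assms by (auto simp: loc_rel_def)
qed

lemma frac_eqI:
  assumes "a \<in> carrier A" "b \<in> carrier A" "s \<in> S" "t \<in> S" "t \<otimes> a = s \<otimes> b"
  shows "frac a s = frac b t"
  unfolding frac_eq_iff[OF assms(1-4)] using one_S assms(5) by (intro bexI[of _ \<one>]) simp_all

text \<open>The operations of \<open>localization\<close> are unions over the members of classes, so
  membership has to be traded for equality of fractions.\<close>

lemma frac_mem_iff:
  assumes "a \<in> carrier A" "s \<in> S"
  shows "(b, t) \<in> frac a s \<longleftrightarrow> b \<in> carrier A \<and> t \<in> S \<and> frac b t = frac a s"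
proof
  assume "(b, t) \<in> frac a s"
  then have r: "((a, s), (b, t)) \<in> loc_rel A S" by (simp add: loc_frac_def)
  then show "b \<in> carrier A \<and> t \<in> S \<and> frac b t = frac a s"
    using equiv_class_eq[OF equiv_loc_rel r] by (auto simp: loc_rel_def loc_frac_def)
next
  assume "b \<in> carrier A \<and> t \<in> S \<and> frac b t = frac a s"
  then show "(b, t) \<in> frac a s"
    using eq_equiv_class_iff[OF equiv_loc_rel, of "(a, s)" "(b, t)"] assms
    by (auto simp: loc_frac_def)
qed

lemma frac_self: "\<lbrakk>a \<in> carrier A; s \<in> S\<rbrakk> \<Longrightarrow> (a, s) \<in> frac a s"
  by (simp add: frac_mem_iff)

lemma frac_closed [simp, intro]: "\<lbrakk>a \<in> carrier A; s \<in> S\<rbrakk> \<Longrightarrow> frac a s \<in> carrier L"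
  by (auto simp: localization_def loc_frac_def intro: quotientI)

lemma frac_cases:
  assumes "x \<in> carrier L"
  obtains a s where "a \<in> carrier A" "s \<in> S" "x = frac a s"
  using assms by (auto simp: localization_def loc_frac_def elim!: quotientE)

text \<open>A class is nonempty by \<open>frac_self\<close>, so a union of a constant family over it
  is that constant. This turns independence of representatives into a value of the
  operation.\<close>

lemma UN_frac_const:
  assumes "a \<in> carrier A" "s \<in> S"
    and "\<And>a' s'. \<lbrakk>a' \<in> carrier A; s' \<in> S; frac a' s' = frac a s\<rbrakk> \<Longrightarrow> F a' s' = K"
  shows "(\<Union>(a', s')\<in>frac a s. F a' s') = K"
proof -
  have "(\<Union>x\<in>frac a s. case x of (a', s') \<Rightarrow> F a' s') = (\<Union>x\<in>frac a s. K)"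
    using assms by (intro SUP_cong) (auto simp: frac_mem_iff)
  then show ?thesis
    using frac_self[OF assms(1,2)] by auto
qed

text \<open>If \<open>u\<close> and \<open>v\<close> witness that two representatives may be
  exchanged, \<open>u \<otimes> v\<close> witnesses the equality of the two products. The same
  multiplier serves \<open>frac_add\<close>.\<close>

lemma frac_mult:
  assumes "a \<in> carrier A" "s \<in> S" "b \<in> carrier A" "t \<in> S"
  shows "frac a s \<otimes>\<^bsub>L\<^esub> frac b t = frac (a \<otimes> b) (s \<otimes> t)"
proof -
  have "frac (a' \<otimes> b') (s' \<otimes> t') = frac (a \<otimes> b) (s \<otimes> t)"
    if a': "a' \<in> carrier A" "s' \<in> S" "frac a' s' = frac a s"
      and b': "b' \<in> carrier A" "t' \<in> S" "frac b' t' = frac b t" for a' s' b' t'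
  proof -
    obtain u v where uv: "u \<in> S" "v \<in> S" "u \<otimes> (s \<otimes> a') = u \<otimes> (s' \<otimes> a)"
      "v \<otimes> (t \<otimes> b') = v \<otimes> (t' \<otimes> b)"
      using a' b' assms by (auto simp: frac_eq_iff)
    have "(u \<otimes> v) \<otimes> ((s \<otimes> t) \<otimes> (a' \<otimes> b')) = (u \<otimes> (s \<otimes> a')) \<otimes> (v \<otimes> (t \<otimes> b'))"
      using uv(1,2) a' b' assms by (simp add: m_ac)
    also have "\<dots> = (u \<otimes> v) \<otimes> ((s' \<otimes> t') \<otimes> (a \<otimes> b))"
      unfolding uv using uv(1,2) a' b' assms by (simp add: m_ac)
    finally have "\<exists>w\<in>S. w \<otimes> ((s \<otimes> t) \<otimes> (a' \<otimes> b')) = w \<otimes> ((s' \<otimes> t') \<otimes> (a \<otimes> b))"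
      using uv(1,2) mult_S by blast
    then show ?thesis
      using a' b' assms mult_S by (simp add: frac_eq_iff)
  qed
  then have "(\<Union>(a', s')\<in>frac a s. \<Union>(b', t')\<in>frac b t. frac (a' \<otimes> b') (s' \<otimes> t')) = frac (a \<otimes> b) (s \<otimes> t)"
    by (intro UN_frac_const assms)
  then show ?thesis
    by (simp add: localization_def)
qed

lemma frac_add:
  assumes "a \<in> carrier A" "s \<in> S" "b \<in> carrier A" "t \<in> S"
  shows "frac a s \<oplus>\<^bsub>L\<^esub> frac b t = frac (t \<otimes> a \<oplus> s \<otimes> b) (s \<otimes> t)"
proof -
  have "frac (t' \<otimes> a' \<oplus> s' \<otimes> b') (s' \<otimes> t') = frac (t \<otimes> a \<oplus> s \<otimes> b) (s \<otimes> t)"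
    if a': "a' \<in> carrier A" "s' \<in> S" "frac a' s' = frac a s"
      and b': "b' \<in> carrier A" "t' \<in> S" "frac b' t' = frac b t" for a' s' b' t'
  proof -
    obtain u v where uv: "u \<in> S" "v \<in> S" "u \<otimes> (s \<otimes> a') = u \<otimes> (s' \<otimes> a)"
      "v \<otimes> (t \<otimes> b') = v \<otimes> (t' \<otimes> b)"
      using a' b' assms by (auto simp: frac_eq_iff)
    have "(u \<otimes> v) \<otimes> ((s \<otimes> t) \<otimes> (t' \<otimes> a' \<oplus> s' \<otimes> b'))
        = (v \<otimes> t \<otimes> t') \<otimes> (u \<otimes> (s \<otimes> a')) \<oplus> (u \<otimes> s \<otimes> s') \<otimes> (v \<otimes> (t \<otimes> b'))"
      using uv(1,2) a' b' assms by (simp add: m_ac r_distr)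
    also have "\<dots> = (u \<otimes> v) \<otimes> ((s' \<otimes> t') \<otimes> (t \<otimes> a \<oplus> s \<otimes> b))"
      unfolding uv using uv(1,2) a' b' assms by (simp add: m_ac r_distr)
    finally have "\<exists>w\<in>S. w \<otimes> ((s \<otimes> t) \<otimes> (t' \<otimes> a' \<oplus> s' \<otimes> b')) = w \<otimes> ((s' \<otimes> t') \<otimes> (t \<otimes> a \<oplus> s \<otimes> b))"
      using uv(1,2) mult_S by blast
    then show ?thesis
      using a' b' assms mult_S by (simp add: frac_eq_iff)
  qed
  then have "(\<Union>(a', s')\<in>frac a s. \<Union>(b', t')\<in>frac b t. frac (t' \<otimes> a' \<oplus> s' \<otimes> b') (s' \<otimes> t')) = frac (t \<otimes> a \<oplus> s \<otimes> b) (s \<otimes> t)"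
    by (intro UN_frac_const assms)
  then show ?thesis
    by (simp add: localization_def)
qed

lemma one_L: "\<one>\<^bsub>L\<^esub> = frac \<one> \<one>" and zero_L: "\<zero>\<^bsub>L\<^esub> = frac \<zero> \<one>"
  by (simp_all add: localization_def)

lemma cring_localization: "cring L"
proof (rule cringI)
  show "abelian_group L"
  proof (rule abelian_groupI)
    fix x y assume "x \<in> carrier L" "y \<in> carrier L"
    then obtain a s b t where "a \<in> carrier A" "s \<in> S" "x = frac a s" "b \<in> carrier A" "t \<in> S" "y = frac b t"
      by (elim frac_cases) blast
    then show "x \<oplus>\<^bsub>L\<^esub> y \<in> carrier L" "x \<oplus>\<^bsub>L\<^esub> y = y \<oplus>\<^bsub>L\<^esub> x"
      using mult_S by (simp_all add: frac_add a_comm m_comm)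
  next
    show "\<zero>\<^bsub>L\<^esub> \<in> carrier L" using one_S by (simp add: zero_L)
  next
    fix x y z assume "x \<in> carrier L" "y \<in> carrier L" "z \<in> carrier L"
    then obtain a s b t c r where "a \<in> carrier A" "s \<in> S" "x = frac a s"
      "b \<in> carrier A" "t \<in> S" "y = frac b t" "c \<in> carrier A" "r \<in> S" "z = frac c r"
      by (elim frac_cases) blast
    then show "x \<oplus>\<^bsub>L\<^esub> y \<oplus>\<^bsub>L\<^esub> z = x \<oplus>\<^bsub>L\<^esub> (y \<oplus>\<^bsub>L\<^esub> z)"
      using mult_S by (simp add: frac_add m_ac a_ac r_distr)
  next
    fix x assume "x \<in> carrier L"
    then obtain a s where x: "a \<in> carrier A" "s \<in> S" "x = frac a s"
      by (elim frac_cases) blast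
    then show "\<zero>\<^bsub>L\<^esub> \<oplus>\<^bsub>L\<^esub> x = x"
      using one_S by (simp add: zero_L frac_add)
    have "frac (\<ominus> a) s \<oplus>\<^bsub>L\<^esub> x = frac \<zero> \<one>"
      unfolding x(3) frac_add[OF a_inv_closed[OF x(1)] x(2) x(1) x(2)]
      using x mult_S one_S by (intro frac_eqI) (simp_all add: l_neg r_minus)
    then show "\<exists>y\<in>carrier L. y \<oplus>\<^bsub>L\<^esub> x = \<zero>\<^bsub>L\<^esub>"
      using x by (intro bexI[of _ "frac (\<ominus> a) s"]) (auto simp: zero_L)
  qed
  show "Group.comm_monoid L"
  proof (rule comm_monoidI)
    fix x y assume "x \<in> carrier L" "y \<in> carrier L"
    then obtain a s b t where "a \<in> carrier A" "s \<in> S" "x = frac a s" "b \<in> carrier A" "t \<in> S" "y = frac b t"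
      by (elim frac_cases) blast
    then show "x \<otimes>\<^bsub>L\<^esub> y \<in> carrier L" "x \<otimes>\<^bsub>L\<^esub> y = y \<otimes>\<^bsub>L\<^esub> x"
      using mult_S by (simp_all add: frac_mult m_comm)
  next
    show "\<one>\<^bsub>L\<^esub> \<in> carrier L" using one_S by (simp add: one_L)
  next
    fix x y z assume "x \<in> carrier L" "y \<in> carrier L" "z \<in> carrier L"
    then obtain a s b t c r where "a \<in> carrier A" "s \<in> S" "x = frac a s"
      "b \<in> carrier A" "t \<in> S" "y = frac b t" "c \<in> carrier A" "r \<in> S" "z = frac c r"
      by (elim frac_cases) blast
    then show "x \<otimes>\<^bsub>L\<^esub> y \<otimes>\<^bsub>L\<^esub> z = x \<otimes>\<^bsub>L\<^esub> (y \<otimes>\<^bsub>L\<^esub> z)"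
      using mult_S by (simp add: frac_mult m_ac)
  next
    fix x assume "x \<in> carrier L"
    then obtain a s where x: "a \<in> carrier A" "s \<in> S" "x = frac a s"
      by (elim frac_cases) blast
    then show "\<one>\<^bsub>L\<^esub> \<otimes>\<^bsub>L\<^esub> x = x"
      using one_S by (simp add: one_L frac_mult)
  qed
next
  fix x y z assume "x \<in> carrier L" "y \<in> carrier L" "z \<in> carrier L"
  then obtain a s b t c r where "a \<in> carrier A" "s \<in> S" "x = frac a s"
    "b \<in> carrier A" "t \<in> S" "y = frac b t" "c \<in> carrier A" "r \<in> S" "z = frac c r"
    by (elim frac_cases) blast
  \<comment> \<open>The right-hand side carries an extra factor \<open>r\<close> in numerator and
    denominator, which \<open>frac_eqI\<close> removes.\<close>
  then show "(x \<oplus>\<^bsub>L\<^esub> y) \<otimes>\<^bsub>L\<^esub> z = x \<otimes>\<^bsub>L\<^esub> z \<oplus>\<^bsub>L\<^esub> y \<otimes>\<^bsub>L\<^esub> z"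
    using mult_S by (simp add: frac_mult frac_add) (rule frac_eqI; simp add: m_ac r_distr)
qed

section \<open>The canonical map, common denominators and the universal property\<close>

lemma loc_map_hom: "loc_map A S \<in> ring_hom A L"
  using one_S by (intro ring_hom_memI) (auto simp: loc_map_def frac_mult frac_add one_L)

lemma frac_eq_mult:
  assumes "a \<in> carrier A" "s \<in> S"
  shows "loc_map A S s \<otimes>\<^bsub>L\<^esub> frac a s = loc_map A S a"
  using assms one_S mult_S unfolding loc_map_def
  by (simp add: frac_mult) (rule frac_eqI; simp)

lemma loc_map_mult_frac:
  "\<lbrakk>a \<in> carrier A; b \<in> carrier A; s \<in> S\<rbrakk> \<Longrightarrow> loc_map A S a \<otimes>\<^bsub>L\<^esub> frac b s = frac (a \<otimes> b) s"
  using one_S by (simp add: loc_map_def frac_mult)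

lemma finsum_frac:
  fixes n :: nat
  assumes f: "\<And>i. i < n \<Longrightarrow> f i \<in> carrier A" and s: "s \<in> S"
  shows "(\<Oplus>\<^bsub>L\<^esub>i\<in>{..<n}. frac (f i) s) = frac (\<Oplus>i\<in>{..<n}. f i) s"
proof -
  interpret L: cring L by (rule cring_localization)
  show ?thesis
    using f
  proof (induction n)
    case 0
    \<comment> \<open>The empty sum is zero over \<open>\<one>\<close>, whereas the claim has
      denominator \<open>s\<close>.\<close>
    have "frac \<zero> \<one> = frac \<zero> s" using s one_S by (intro frac_eqI) simp_all
    then show ?case
      by (simp add: zero_L)
  next
    case (Suc n)
    define t where "t = (\<Oplus>i\<in>{..<n}. f i)"
    have t: "t \<in> carrier A" unfolding t_def using Suc.prems by (intro finsum_closed) auto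
    have fn: "f n \<in> carrier A" using Suc.prems by simp
    have "(\<Oplus>\<^bsub>L\<^esub>i\<in>{..<Suc n}. frac (f i) s) = frac (f n) s \<oplus>\<^bsub>L\<^esub> (\<Oplus>\<^bsub>L\<^esub>i\<in>{..<n}. frac (f i) s)"
      unfolding lessThan_Suc using Suc.prems s by (intro L.finsum_insert) auto
    also have "\<dots> = frac (f n) s \<oplus>\<^bsub>L\<^esub> frac t s"
      unfolding t_def using Suc by simp
    \<comment> \<open>\<open>frac_add\<close> produces the denominator \<open>s \<otimes> s\<close>,
      of which one factor cancels.\<close>
    also have "\<dots> = frac (f n \<oplus> t) s"
      unfolding frac_add[OF fn s t s] using fn t s mult_S
      by (intro frac_eqI) (simp_all add: r_distr m_ac)
    also have "f n \<oplus> t = (\<Oplus>i\<in>{..<Suc n}. f i)"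
      unfolding t_def lessThan_Suc using Suc.prems by (intro finsum_insert[symmetric]) auto
    finally show ?case .
  qed
qed

text \<open>Adjoining \<open>b/t\<close> to fractions over \<open>s\<close>, the denominator becomes
  \<open>s \<otimes> t\<close>, and numerators are multiplied by the missing factor. This reduces
  finite sets of fractions to finite sets of numerators.\<close>

lemma common_denominator:
  assumes "finite K" "K \<subseteq> carrier L"
  shows "\<exists>s\<in>S. \<forall>x\<in>K. \<exists>a\<in>carrier A. x = frac a s"
  using assms
proof (induction K rule: finite_induct)
  case empty
  then show ?case using one_S by blast
next
  case (insert y K)
  then obtain s where s: "s \<in> S" and K: "\<And>x. x \<in> K \<Longrightarrow> \<exists>a\<in>carrier A. x = frac a s" by auto
  obtain b t where b: "b \<in> carrier A" "t \<in> S" "y = frac b t"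
    using insert.prems by (auto elim: frac_cases)
  have "\<exists>a\<in>carrier A. x = frac a (s \<otimes> t)" if x: "x \<in> K" for x
  proof -
    obtain a where a: "a \<in> carrier A" "x = frac a s" using K[OF x] by blast
    have "frac a s = frac (t \<otimes> a) (s \<otimes> t)"
      using a(1) b(2) s mult_S by (intro frac_eqI) (simp_all add: m_ac)
    then show ?thesis using a b(2) by blast
  qed
  moreover have "frac b t = frac (s \<otimes> b) (s \<otimes> t)"
    using b(1,2) s mult_S by (intro frac_eqI) (simp_all add: m_ac)
  ultimately show ?case
    using b s mult_S by (intro bexI[of _ "s \<otimes> t"]) auto
qed

text \<open>The lift sends \<open>a/s\<close> to \<open>h a\<close> times the inverse of
  \<open>h s\<close>. It is applied to quotients of \<open>R[X]\<close> in which the members of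
  \<open>Sigma_T1 R\<close> become units.\<close>

theorem localization_lift:
  assumes B: "cring B" and h: "h \<in> ring_hom A B" and U: "h ` S \<subseteq> Units B"
  obtains \<phi> where "\<phi> \<in> ring_hom L B" "\<And>a. a \<in> carrier A \<Longrightarrow> \<phi> (loc_map A S a) = h a"
proof -
  interpret B: cring B by fact
  interpret h: ring_hom_cring A B h
    by (intro ring_hom_cring.intro ring_hom_cring_axioms.intro is_cring B h)
  define k where "k = (\<lambda>(a, s). h a \<otimes>\<^bsub>B\<^esub> inv\<^bsub>B\<^esub> h s)"
  have hU: "h s \<in> Units B" if "s \<in> S" for s using U that by blast
  \<comment> \<open>The next two facts characterise \<open>k (a, s)\<close> as the only
    \<open>c\<close> with \<open>h a = c \<otimes> h s\<close>, so that inverses no longer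
    appear.\<close>
  have k_eq: "k (a, s) = c" if "a \<in> carrier A" "s \<in> S" "c \<in> carrier B" "h a = c \<otimes>\<^bsub>B\<^esub> h s" for a s c
    using that hU[of s] by (simp add: k_def B.m_assoc)
  have k_cl: "k (a, s) \<in> carrier B" "k (a, s) \<otimes>\<^bsub>B\<^esub> h s = h a" if "a \<in> carrier A" "s \<in> S" for a s
    using that hU[of s] by (simp_all add: k_def B.m_assoc)
  have k_frac: "k (a, s) = k (b, t)"
    if c: "a \<in> carrier A" "s \<in> S" "b \<in> carrier A" "t \<in> S" "frac a s = frac b t" for a s b t
  proof -
    obtain u where u: "u \<in> S" "u \<otimes> (t \<otimes> a) = u \<otimes> (s \<otimes> b)"
      using c frac_eq_iff[OF c(1,3,2,4)] by blast
    then have "h u \<otimes>\<^bsub>B\<^esub> (h t \<otimes>\<^bsub>B\<^esub> h a) = h u \<otimes>\<^bsub>B\<^esub> (h s \<otimes>\<^bsub>B\<^esub> h b)"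
      using c by (metis S_closed h.hom_mult m_closed)
    \<comment> \<open>The multiplier \<open>u\<close> cancels in \<open>B\<close> because
      \<open>h u\<close> is a unit.\<close>
    then have *: "h t \<otimes>\<^bsub>B\<^esub> h a = h s \<otimes>\<^bsub>B\<^esub> h b"
      using u hU c by simp
    have "h t \<otimes>\<^bsub>B\<^esub> h a = h t \<otimes>\<^bsub>B\<^esub> (k (b, t) \<otimes>\<^bsub>B\<^esub> h s)"
    proof -
      have "h t \<otimes>\<^bsub>B\<^esub> h a = h s \<otimes>\<^bsub>B\<^esub> (k (b, t) \<otimes>\<^bsub>B\<^esub> h t)"
        using * k_cl c by simp
      then show ?thesis using k_cl c by (simp add: B.m_ac)
    qed
    then have "h a = k (b, t) \<otimes>\<^bsub>B\<^esub> h s"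
      using hU c k_cl by simp
    then show ?thesis by (intro k_eq k_cl(1) c)
  qed
  \<comment> \<open>By \<open>k_frac\<close> the image of a class under \<open>k\<close> is a
    singleton.\<close>
  define \<phi> where "\<phi> = (\<lambda>C. the_elem (k ` C))"
  have \<phi>: "\<phi> (frac a s) = k (a, s)" if c: "a \<in> carrier A" "s \<in> S" for a s
  proof -
    have "k ` frac a s = {k (a, s)}"
    proof -
      have "k x = k (a, s)" if "x \<in> frac a s" for x
      proof -
        obtain b t where x: "x = (b, t)" by (cases x)
        with that have "b \<in> carrier A" "t \<in> S" "frac b t = frac a s"
          using frac_mem_iff[OF c] by auto
        then show ?thesis unfolding x using c by (intro k_frac)
      qed
      then show ?thesis using frac_self[OF c] by blast
    qed
    then show ?thesis by (simp add: \<phi>_def)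
  qed
  have "\<phi> \<in> ring_hom L B"
  proof (rule ring_hom_memI)
    fix x assume "x \<in> carrier L"
    then show "\<phi> x \<in> carrier B" by (rule frac_cases) (simp add: \<phi> k_cl(1))
  next
    fix x y assume "x \<in> carrier L" "y \<in> carrier L"
    then obtain a s b t where c: "a \<in> carrier A" "s \<in> S" "b \<in> carrier A" "t \<in> S"
      and x: "x = frac a s" and y: "y = frac b t"
      by (elim frac_cases) blast
    have kc: "k (a, s) \<in> carrier B" "k (b, t) \<in> carrier B" and ha: "h a = k (a, s) \<otimes>\<^bsub>B\<^esub> h s"
      and hb: "h b = k (b, t) \<otimes>\<^bsub>B\<^esub> h t"
      using k_cl c by auto
    show "\<phi> (x \<otimes>\<^bsub>L\<^esub> y) = \<phi> x \<otimes>\<^bsub>B\<^esub> \<phi> y"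
      unfolding x y using c mult_S kc
      by (simp add: frac_mult \<phi>) (intro k_eq; simp add: ha hb B.m_ac)
    show "\<phi> (x \<oplus>\<^bsub>L\<^esub> y) = \<phi> x \<oplus>\<^bsub>B\<^esub> \<phi> y"
      unfolding x y using c mult_S kc
      by (simp add: frac_add \<phi>) (intro k_eq; simp add: ha hb B.m_ac B.r_distr)
  next
    show "\<phi> \<one>\<^bsub>L\<^esub> = \<one>\<^bsub>B\<^esub>"
      using one_S by (simp add: one_L \<phi>) (intro k_eq; simp)
  qed
  moreover have "\<phi> (loc_map A S a) = h a" if "a \<in> carrier A" for a
    using that one_S by (simp add: loc_map_def \<phi>) (intro k_eq; simp)
  ultimately show thesis using that by blast
qed

end

section \<open>Tensor products and flatness\<close>

lemma linear_mapsD: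
  assumes "f \<in> linear_maps R M N"
  shows "x \<in> carrier M \<Longrightarrow> f x \<in> carrier N"
    and "\<lbrakk>x \<in> carrier M; y \<in> carrier M\<rbrakk> \<Longrightarrow> f (x \<oplus>\<^bsub>M\<^esub> y) = f x \<oplus>\<^bsub>N\<^esub> f y"
    and "\<lbrakk>r \<in> carrier R; x \<in> carrier M\<rbrakk> \<Longrightarrow> f (r \<odot>\<^bsub>M\<^esub> x) = r \<odot>\<^bsub>N\<^esub> f x"
  using assms by (auto simp: linear_maps_def)

lemma linear_map_zero_minus:
  assumes "f \<in> linear_maps R M N" "module R M" "module R N"
  shows "f \<zero>\<^bsub>M\<^esub> = \<zero>\<^bsub>N\<^esub>"
    and "\<lbrakk>x \<in> carrier M; y \<in> carrier M\<rbrakk> \<Longrightarrow> f (x \<ominus>\<^bsub>M\<^esub> y) = f x \<ominus>\<^bsub>N\<^esub> f y"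
proof -
  interpret M: module R M by fact
  interpret N: module R N by fact
  interpret f: abelian_group_hom M N f
    by (intro abelian_group_homI M.abelian_group_axioms N.abelian_group_axioms
        group_hom.intro group_hom_axioms.intro M.a_group N.a_group homI)
      (use linear_mapsD[OF assms(1)] in simp_all)
  show "f \<zero>\<^bsub>M\<^esub> = \<zero>\<^bsub>N\<^esub>" by simp
  show "f (x \<ominus>\<^bsub>M\<^esub> y) = f x \<ominus>\<^bsub>N\<^esub> f y" if "x \<in> carrier M" "y \<in> carrier M"
    using that by (simp add: a_minus_def)
qed

text \<open>\<open>module_via\<close> along the identity makes \<open>R\<close> a module over
  itself, so these are the elements of the dual of \<open>M\<close>.\<close>

abbreviation linear_forms where
  "linear_forms R M \<equiv> linear_maps R M (module_via (\<lambda>r. r) R)"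

lemma linear_formsD:
  assumes "l \<in> linear_forms R M"
  shows "x \<in> carrier M \<Longrightarrow> l x \<in> carrier R"
    and "\<lbrakk>x \<in> carrier M; y \<in> carrier M\<rbrakk> \<Longrightarrow> l (x \<oplus>\<^bsub>M\<^esub> y) = l x \<oplus>\<^bsub>R\<^esub> l y"
    and "\<lbrakk>r \<in> carrier R; x \<in> carrier M\<rbrakk> \<Longrightarrow> l (r \<odot>\<^bsub>M\<^esub> x) = r \<otimes>\<^bsub>R\<^esub> l x"
  using linear_mapsD[OF assms] by (simp_all add: module_via_def)

text \<open>Negatives and sums arise from differences with \<open>0\<close>. The criterion is
  phrased additively although \<open>free_Abelian_group\<close> is a multiplicative
  structure.\<close>

lemma subgroup_free_Abelian_groupI:
  assumes "H \<subseteq> carrier (free_Abelian_group A)" "0 \<in> H" "\<And>a b. \<lbrakk>a \<in> H; b \<in> H\<rbrakk> \<Longrightarrow> a - b \<in> H"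
  shows "subgroup H (free_Abelian_group A)"
proof -
  have neg: "- a \<in> H" if "a \<in> H" for a
    using assms(3)[OF assms(2) that] by simp
  have "a + b \<in> H" if "a \<in> H" "b \<in> H" for a b
    using assms(3)[OF that(1) neg[OF that(2)]] by simp
  moreover have "inv\<^bsub>free_Abelian_group A\<^esub> a = - a" if "a \<in> H" for a
    using assms(1) that by (intro inv_free_Abelian_group) (auto simp: subset_iff)
  ultimately show ?thesis
    using assms(1,2) neg by (intro group.subgroupI group_free_Abelian_group) auto
qed

text \<open>Elements of the tensor product are handled through representatives in the free abelian
  group \<open>F\<close>; equality becomes membership of a difference in \<open>T\<close>.\<close>

locale tensor_pair = M: module R M + N: module R N
  for R :: "('r, 'k) ring_scheme" and M :: "('r, 'a, 'm) module_scheme"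
    and N :: "('r, 'b, 'n) module_scheme"
begin

abbreviation F where "F \<equiv> free_Abelian_group (carrier M \<times> carrier N)"
abbreviation T where "T \<equiv> tensor_subgroup R M N"

section \<open>Calculation modulo the tensor relations\<close>

lemma F_diff: "\<lbrakk>c \<in> carrier F; d \<in> carrier F\<rbrakk> \<Longrightarrow> c - d \<in> carrier F"
  using keys_diff[of c d] by auto

lemma F_frag: "\<lbrakk>x \<in> carrier M; y \<in> carrier N\<rbrakk> \<Longrightarrow> frag_of (x, y) \<in> carrier F"
  by simp

lemma tensor_relators_subset: "tensor_relators R M N \<subseteq> carrier F"
  unfolding tensor_relators_def
  by (auto simp: keys_frag_of dest!: subsetD[OF keys_diff])

lemma subgroup_T: "subgroup T F"
  unfolding tensor_subgroup_def
  by (intro group.generate_is_subgroup group_free_Abelian_group tensor_relators_subset)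

lemma T_subset: "c \<in> T \<Longrightarrow> c \<in> carrier F"
  using subgroup.subset[OF subgroup_T] by blast

lemma T_zero [simp]: "0 \<in> T"
  using subgroup.one_closed[OF subgroup_T] by simp

lemma T_add: "\<lbrakk>c \<in> T; d \<in> T\<rbrakk> \<Longrightarrow> c + d \<in> T"
  using subgroup.m_closed[OF subgroup_T] by simp

lemma T_minus: "c \<in> T \<Longrightarrow> - c \<in> T"
  using subgroup.m_inv_closed[OF subgroup_T] T_subset by force

lemma T_diff: "\<lbrakk>c \<in> T; d \<in> T\<rbrakk> \<Longrightarrow> c - d \<in> T"
  using T_add[of c "- d"] T_minus by simp

lemma T_diff_trans: "\<lbrakk>c - d \<in> T; d - e \<in> T\<rbrakk> \<Longrightarrow> c - e \<in> T"
  using T_add[of "c - d" "d - e"] by simp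

lemma T_sum: "(\<And>i. i \<in> I \<Longrightarrow> f i \<in> T) \<Longrightarrow> sum f I \<in> T"
  by (induction I rule: infinite_finite_induct) (auto intro: T_add)

lemma T_relators: "c \<in> tensor_relators R M N \<Longrightarrow> c \<in> T"
  unfolding tensor_subgroup_def by (rule generate.incl)

lemma T_add_left: "\<lbrakk>x \<in> carrier M; x' \<in> carrier M; y \<in> carrier N\<rbrakk>
    \<Longrightarrow> frag_of (x \<oplus>\<^bsub>M\<^esub> x', y) - frag_of (x, y) - frag_of (x', y) \<in> T"
  by (rule T_relators) (auto simp: tensor_relators_def)

lemma T_add_right: "\<lbrakk>x \<in> carrier M; y \<in> carrier N; y' \<in> carrier N\<rbrakk>
    \<Longrightarrow> frag_of (x, y \<oplus>\<^bsub>N\<^esub> y') - frag_of (x, y) - frag_of (x, y') \<in> T"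
  by (rule T_relators) (auto simp: tensor_relators_def)

lemma T_smult: "\<lbrakk>r \<in> carrier R; x \<in> carrier M; y \<in> carrier N\<rbrakk>
    \<Longrightarrow> frag_of (r \<odot>\<^bsub>M\<^esub> x, y) - frag_of (x, r \<odot>\<^bsub>N\<^esub> y) \<in> T"
  by (rule T_relators) (auto simp: tensor_relators_def)

text \<open>The additivity relator for the sum of two zeros is the negative of this
  generator.\<close>

lemma T_zero_left: "y \<in> carrier N \<Longrightarrow> frag_of (\<zero>\<^bsub>M\<^esub>, y) \<in> T"
  using T_minus[OF T_add_left[of "\<zero>\<^bsub>M\<^esub>" "\<zero>\<^bsub>M\<^esub>" y]] by simp

lemma T_zero_right: "x \<in> carrier M \<Longrightarrow> frag_of (x, \<zero>\<^bsub>N\<^esub>) \<in> T"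
  using T_minus[OF T_add_right[of x "\<zero>\<^bsub>N\<^esub>" "\<zero>\<^bsub>N\<^esub>"]] by simp

lemma T_minus_right:
  assumes "x \<in> carrier M" "y \<in> carrier N" "y' \<in> carrier N"
  shows "frag_of (x, y \<ominus>\<^bsub>N\<^esub> y') - (frag_of (x, y) - frag_of (x, y')) \<in> T"
proof -
  have "(y \<ominus>\<^bsub>N\<^esub> y') \<oplus>\<^bsub>N\<^esub> y' = y"
    using assms by (simp add: a_minus_def N.a_assoc N.l_neg)
  then show ?thesis
    using T_minus[OF T_add_right[of x "y \<ominus>\<^bsub>N\<^esub> y'" y']] assms by (simp add: algebra_simps)
qed

lemma T_finsum_left:
  fixes n :: nat
  assumes "\<And>i. i < n \<Longrightarrow> v i \<in> carrier M" "y \<in> carrier N"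
  shows "frag_of (\<Oplus>\<^bsub>M\<^esub>i\<in>{..<n}. v i, y) - (\<Sum>i<n. frag_of (v i, y)) \<in> T"
  using assms(1)
proof (induction n)
  case 0
  then show ?case by (simp add: T_zero_left assms)
next
  case (Suc n)
  define s where "s = (\<Oplus>\<^bsub>M\<^esub>i\<in>{..<n}. v i)"
  have s: "s \<in> carrier M" unfolding s_def using Suc.prems by (intro M.finsum_closed) auto
  have "(\<Oplus>\<^bsub>M\<^esub>i\<in>{..<Suc n}. v i) = v n \<oplus>\<^bsub>M\<^esub> s"
    unfolding s_def lessThan_Suc using Suc.prems by (intro M.finsum_insert) auto
  moreover have "(frag_of (v n \<oplus>\<^bsub>M\<^esub> s, y) - frag_of (v n, y) - frag_of (s, y))
      + (frag_of (s, y) - (\<Sum>i<n. frag_of (v i, y))) \<in> T"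
    using Suc s assms(2) unfolding s_def by (intro T_add T_add_left) auto
  ultimately show ?case by (simp add: algebra_simps)
qed

text \<open>\<open>T\<close> is the least subgroup containing the relators, and the elements of
  \<open>F\<close> satisfying \<open>P\<close> form a subgroup. The rule serves to show that maps
  out of \<open>F\<close> respect the relations.\<close>

lemma T_induct [consumes 1, case_names zero add_left add_right smult diff]:
  assumes "c \<in> T" and "P 0"
    and "\<And>x x' y. \<lbrakk>x \<in> carrier M; x' \<in> carrier M; y \<in> carrier N\<rbrakk>
      \<Longrightarrow> P (frag_of (x \<oplus>\<^bsub>M\<^esub> x', y) - frag_of (x, y) - frag_of (x', y))"
    and "\<And>x y y'. \<lbrakk>x \<in> carrier M; y \<in> carrier N; y' \<in> carrier N\<rbrakk>
      \<Longrightarrow> P (frag_of (x, y \<oplus>\<^bsub>N\<^esub> y') - frag_of (x, y) - frag_of (x, y'))"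
    and "\<And>r x y. \<lbrakk>r \<in> carrier R; x \<in> carrier M; y \<in> carrier N\<rbrakk>
      \<Longrightarrow> P (frag_of (r \<odot>\<^bsub>M\<^esub> x, y) - frag_of (x, r \<odot>\<^bsub>N\<^esub> y))"
    and diff: "\<And>a b. \<lbrakk>a \<in> carrier F; b \<in> carrier F; P a; P b\<rbrakk> \<Longrightarrow> P (a - b)"
  shows "P c"
proof -
  have "subgroup {c \<in> carrier F. P c} F"
    using assms(2) diff F_diff by (intro subgroup_free_Abelian_groupI) auto
  moreover have "tensor_relators R M N \<subseteq> {c \<in> carrier F. P c}"
  proof
    fix c assume c: "c \<in> tensor_relators R M N"
    then have "P c"
      unfolding tensor_relators_def
      by (elim UnE CollectE exE conjE) (simp_all only: assms(3-5))
    with c show "c \<in> {c \<in> carrier F. P c}" using tensor_relators_subset by blast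
  qed
  ultimately have "T \<subseteq> {c \<in> carrier F. P c}"
    unfolding tensor_subgroup_def by (intro group.generate_subgroup_incl group_free_Abelian_group)
  then show ?thesis using assms(1) by blast
qed

lemma coset_eq_iff:
  assumes "c \<in> carrier F" "d \<in> carrier F"
  shows "T #>\<^bsub>F\<^esub> c = T #>\<^bsub>F\<^esub> d \<longleftrightarrow> c - d \<in> T"
proof
  assume "T #>\<^bsub>F\<^esub> c = T #>\<^bsub>F\<^esub> d"
  moreover have "c \<in> T #>\<^bsub>F\<^esub> c" unfolding r_coset_def by (auto intro!: bexI[of _ 0])
  ultimately have "c \<in> T #>\<^bsub>F\<^esub> d" by simp
  then show "c - d \<in> T" unfolding r_coset_def by auto
next
  assume cd: "c - d \<in> T"
  have "t + c = (t + (c - d)) + d" "t + d = (t - (c - d)) + c" for t by simp_all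
  then show "T #>\<^bsub>F\<^esub> c = T #>\<^bsub>F\<^esub> d"
    unfolding r_coset_def using T_add[OF _ cd] T_diff[OF _ cd] by (auto, metis, metis)
qed

lemma coset_zero: "T #>\<^bsub>F\<^esub> 0 = T"
  by (auto simp: r_coset_def)

lemma carrier_tensor_product: "carrier (tensor_product R M N) = (\<lambda>c. T #>\<^bsub>F\<^esub> c) ` carrier F"
  by (auto simp: tensor_product_def FactGroup_def RCOSETS_def)

lemma one_tensor_product: "\<one>\<^bsub>tensor_product R M N\<^esub> = T"
  by (simp add: tensor_product_def FactGroup_def)

text \<open>The map \<open>l \<otimes> 1 : M \<otimes> N \<rightarrow> N\<close>, on representatives in the free abelian group.\<close>

definition contraction :: "('a \<Rightarrow> 'r) \<Rightarrow> (('a \<times> 'b) \<Rightarrow>\<^sub>0 int) \<Rightarrow> 'b"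
  where "contraction l = (SOME h. h \<in> hom F (add_monoid N) \<and>
    (\<forall>x\<in>carrier M. \<forall>y\<in>carrier N. h (frag_of (x, y)) = l x \<odot>\<^bsub>N\<^esub> y))"

section \<open>Properties of the contraction \<open>l \<otimes> 1\<close>\<close>

lemma minus_eq_zeroD:
  assumes "x \<ominus>\<^bsub>N\<^esub> y = \<zero>\<^bsub>N\<^esub>" "x \<in> carrier N" "y \<in> carrier N"
  shows "x = y"
  using N.minus_equality[of x "\<ominus>\<^bsub>N\<^esub> y"] assms by (simp add: a_minus_def)

text \<open>Additivity relators take this shape after \<open>contraction\<close> is applied.\<close>

lemma add_minus_minus:
  assumes "x \<in> carrier N" "y \<in> carrier N"
  shows "(x \<oplus>\<^bsub>N\<^esub> y) \<ominus>\<^bsub>N\<^esub> x \<ominus>\<^bsub>N\<^esub> y = \<zero>\<^bsub>N\<^esub>"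
proof -
  have "(x \<oplus>\<^bsub>N\<^esub> y) \<ominus>\<^bsub>N\<^esub> x = (y \<oplus>\<^bsub>N\<^esub> x) \<ominus>\<^bsub>N\<^esub> x"
    using assms by (simp add: N.a_comm)
  also have "\<dots> = y"
    using assms by (simp add: a_minus_def N.a_assoc N.r_neg)
  finally show ?thesis
    using assms by (simp add: a_minus_def N.r_neg)
qed

context
  fixes l assumes l: "l \<in> linear_forms R M"
begin

text \<open>The universal property of the free abelian group, applied to the map taking
  \<open>(x, y)\<close> to \<open>l x \<odot> y\<close>, shows that the choice in the definition
  succeeds.\<close>

lemma contraction: "contraction l \<in> hom F (add_monoid N)"
  "\<lbrakk>x \<in> carrier M; y \<in> carrier N\<rbrakk> \<Longrightarrow> contraction l (frag_of (x, y)) = l x \<odot>\<^bsub>N\<^esub> y"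
proof -
  have "(\<lambda>(x, y). l x \<odot>\<^bsub>N\<^esub> y) ` (carrier M \<times> carrier N) \<subseteq> carrier (add_monoid N)"
    using linear_formsD(1)[OF l] by auto
  then obtain h where "h \<in> hom F (add_monoid N)"
    "\<And>p. p \<in> carrier M \<times> carrier N \<Longrightarrow> h (frag_of p) = (case p of (x, y) \<Rightarrow> l x \<odot>\<^bsub>N\<^esub> y)"
    using comm_group.free_Abelian_group_universal[OF N.a_comm_group] by metis
  then have "\<exists>h. h \<in> hom F (add_monoid N) \<and>
      (\<forall>x\<in>carrier M. \<forall>y\<in>carrier N. h (frag_of (x, y)) = l x \<odot>\<^bsub>N\<^esub> y)" by auto
  from someI_ex[OF this, folded contraction_def]
  show "contraction l \<in> hom F (add_monoid N)"
    "\<lbrakk>x \<in> carrier M; y \<in> carrier N\<rbrakk> \<Longrightarrow> contraction l (frag_of (x, y)) = l x \<odot>\<^bsub>N\<^esub> y" by auto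
qed

lemma contraction_closed: "c \<in> carrier F \<Longrightarrow> contraction l c \<in> carrier N"
  using contraction(1) by (auto simp: hom_def)

lemma contraction_zero: "contraction l 0 = \<zero>\<^bsub>N\<^esub>"
  using hom_one[OF contraction(1)] N.a_group by simp

lemma contraction_diff:
  assumes "c \<in> carrier F" "d \<in> carrier F"
  shows "contraction l (c - d) = contraction l c \<ominus>\<^bsub>N\<^esub> contraction l d"
proof -
  have cd: "c - d \<in> carrier F" using assms keys_diff[of c d] by auto
  have "contraction l ((c - d) + d) = contraction l (c - d) \<oplus>\<^bsub>N\<^esub> contraction l d"
    using hom_mult[OF contraction(1) cd assms(2)] by simp
  then show ?thesis
    using contraction_closed assms cd by (simp add: a_minus_def N.a_assoc N.r_neg)
qed

text \<open>The expression \<open>l x \<odot> y\<close> is bilinear over \<open>R\<close>, so each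
  relator is killed and \<open>contraction l\<close> descends to the tensor product. The scalar
  relator uses commutativity of \<open>R\<close>.\<close>

lemma contraction_T:
  assumes "c \<in> T"
  shows "contraction l c = \<zero>\<^bsub>N\<^esub>"
  using assms
proof (induction c rule: T_induct)
  case zero
  show ?case by (rule contraction_zero)
next
  case (diff a b)
  then show ?case by (simp only: contraction_diff) (simp add: a_minus_def)
next
  case (add_left x x' y)
  have "contraction l (frag_of (x \<oplus>\<^bsub>M\<^esub> x', y) - frag_of (x, y) - frag_of (x', y))
      = (l x \<oplus>\<^bsub>R\<^esub> l x') \<odot>\<^bsub>N\<^esub> y \<ominus>\<^bsub>N\<^esub> l x \<odot>\<^bsub>N\<^esub> y \<ominus>\<^bsub>N\<^esub> l x' \<odot>\<^bsub>N\<^esub> y"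
    using add_left by (simp only: F_diff F_frag contraction_diff contraction(2) M.add.m_closed linear_formsD(2)[OF l])
  then show ?case
    using add_left linear_formsD(1)[OF l] by (simp add: N.smult_l_distr add_minus_minus)
next
  case (add_right x y y')
  have "contraction l (frag_of (x, y \<oplus>\<^bsub>N\<^esub> y') - frag_of (x, y) - frag_of (x, y'))
      = l x \<odot>\<^bsub>N\<^esub> (y \<oplus>\<^bsub>N\<^esub> y') \<ominus>\<^bsub>N\<^esub> l x \<odot>\<^bsub>N\<^esub> y \<ominus>\<^bsub>N\<^esub> l x \<odot>\<^bsub>N\<^esub> y'"
    using add_right by (simp only: F_diff F_frag contraction_diff contraction(2) N.add.m_closed)
  then show ?case
    using add_right linear_formsD(1)[OF l] by (simp add: N.smult_r_distr add_minus_minus)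
next
  case (smult r x y)
  have "contraction l (frag_of (r \<odot>\<^bsub>M\<^esub> x, y) - frag_of (x, r \<odot>\<^bsub>N\<^esub> y))
      = (r \<otimes>\<^bsub>R\<^esub> l x) \<odot>\<^bsub>N\<^esub> y \<ominus>\<^bsub>N\<^esub> l x \<odot>\<^bsub>N\<^esub> (r \<odot>\<^bsub>N\<^esub> y)"
    using smult by (simp only: F_frag contraction_diff contraction(2) M.smult_closed N.smult_closed linear_formsD(3)[OF l])
  also have "\<dots> = (r \<otimes>\<^bsub>R\<^esub> l x) \<odot>\<^bsub>N\<^esub> y \<ominus>\<^bsub>N\<^esub> (l x \<otimes>\<^bsub>R\<^esub> r) \<odot>\<^bsub>N\<^esub> y"
    using smult linear_formsD(1)[OF l] by (simp only: N.smult_assoc1)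
  finally show ?case
    using smult linear_formsD(1)[OF l] by (simp add: M.R.m_comm a_minus_def N.M.r_neg)
qed

end

text \<open>On a generator \<open>(x, y)\<close> with \<open>x \<in> K\<close>, expand
  \<open>x\<close> by the dual system and move the scalars \<open>l i x\<close> across the tensor
  sign. Modulo \<open>T\<close> both sides are additive in \<open>c\<close>, which gives the general
  case.\<close>

lemma contraction_expansion:
  fixes n :: nat
  assumes b: "\<And>i. i < n \<Longrightarrow> b i \<in> carrier M"
    and l: "\<And>i. i < n \<Longrightarrow> l i \<in> linear_forms R M"
    and K: "K \<subseteq> carrier M" "\<And>x. x \<in> K \<Longrightarrow> x = (\<Oplus>\<^bsub>M\<^esub>i\<in>{..<n}. l i x \<odot>\<^bsub>M\<^esub> b i)"
    and c: "Poly_Mapping.keys c \<subseteq> K \<times> carrier N"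
  shows "c - (\<Sum>i<n. frag_of (b i, contraction (l i) c)) \<in> T"
  using c
proof (induction c rule: free_Abelian_group_induct[consumes 1, case_names zero diff one])
  case zero
  have "(\<Sum>i<n. frag_of (b i, contraction (l i) 0)) \<in> T"
    using b l by (intro T_sum) (simp add: contraction_zero T_zero_right)
  then show ?case using T_minus by simp
next
  case (diff c d)
  have cl: "c \<in> carrier F" "d \<in> carrier F" using diff K(1) by auto
  \<comment> \<open>\<open>contraction\<close> takes differences to differences in \<open>N\<close>;
    only modulo \<open>T\<close> does this become a difference of generators.\<close>
  have "(\<Sum>i<n. frag_of (b i, contraction (l i) (c - d)) -
      (frag_of (b i, contraction (l i) c) - frag_of (b i, contraction (l i) d))) \<in> T"
  proof (rule T_sum)
    fix i assume "i \<in> {..<n}"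
    then show "frag_of (b i, contraction (l i) (c - d)) -
      (frag_of (b i, contraction (l i) c) - frag_of (b i, contraction (l i) d)) \<in> T"
      using b l cl
      by (simp only: contraction_diff lessThan_iff) (intro T_minus_right contraction_closed; simp)
  qed
  from T_diff[OF T_diff[OF diff(3,4)] this] show ?case
    unfolding sum_subtractf by simp
next
  case (one p)
  then obtain x y where p: "p = (x, y)" "x \<in> K" "x \<in> carrier M" "y \<in> carrier N"
    using K(1) by blast
  have cl: "l i x \<in> carrier R" "b i \<in> carrier M" if "i < n" for i
    by (rule linear_formsD(1)[OF l[OF that] p(3)]) (rule b[OF that])
  have "frag_of (\<Oplus>\<^bsub>M\<^esub>i\<in>{..<n}. l i x \<odot>\<^bsub>M\<^esub> b i, y) - (\<Sum>i<n. frag_of (l i x \<odot>\<^bsub>M\<^esub> b i, y)) \<in> T"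
    using cl p(4) by (intro T_finsum_left) auto
  then have 1: "frag_of (x, y) - (\<Sum>i<n. frag_of (l i x \<odot>\<^bsub>M\<^esub> b i, y)) \<in> T"
    unfolding K(2)[OF p(2), symmetric] .
  have 2: "(\<Sum>i<n. frag_of (l i x \<odot>\<^bsub>M\<^esub> b i, y)) - (\<Sum>i<n. frag_of (b i, l i x \<odot>\<^bsub>N\<^esub> y)) \<in> T"
    unfolding sum_subtractf[symmetric] using cl p(4) by (intro T_sum T_smult) auto
  have "(\<Sum>i<n. frag_of (b i, contraction (l i) (frag_of (x, y)))) = (\<Sum>i<n. frag_of (b i, l i x \<odot>\<^bsub>N\<^esub> y))"
    using l p(3,4) by (intro sum.cong refl) (simp add: contraction(2))
  then show ?case
    using T_diff_trans[OF 1 2] by (simp only: p(1))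
qed

end

section \<open>The map \<open>1 \<otimes> f\<close> on representatives\<close>

definition extend_right :: "('b \<Rightarrow> 'c) \<Rightarrow> (('a \<times> 'b) \<Rightarrow>\<^sub>0 int) \<Rightarrow> (('a \<times> 'c) \<Rightarrow>\<^sub>0 int)"
  where "extend_right f = frag_extend (\<lambda>(x, y). frag_of (x, f y))"

lemma extend_right_simps [simp]:
  "extend_right f 0 = 0"
  "extend_right f (frag_of (x, y)) = frag_of (x, f y)"
  "extend_right f (c + d) = extend_right f c + extend_right f d"
  "extend_right f (c - d) = extend_right f c - extend_right f d"
  by (simp_all add: extend_right_def frag_extend_add frag_extend_diff)

lemma extend_right_sum: "extend_right f (sum g I) = (\<Sum>i\<in>I. extend_right f (g i))"
  by (induction I rule: infinite_finite_induct) simp_all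

locale tensor_pair_map = N: tensor_pair R M N + N': tensor_pair R M N'
  for R :: "('r, 'k) ring_scheme" and M :: "('r, 'a, 'm) module_scheme"
    and N :: "('r, 'b, 'n) module_scheme" and N' :: "('r, 'c, 'p) module_scheme" +
  fixes f assumes f: "f \<in> linear_maps R N N'"
begin

lemmas f_simps = linear_mapsD[OF f]

lemma extend_right_F:
  assumes "c \<in> carrier N.F"
  shows "extend_right f c \<in> carrier N'.F"
proof -
  have "Poly_Mapping.keys (case p of (x, y) \<Rightarrow> frag_of (x, f y)) \<subseteq> carrier M \<times> carrier N'"
    if "p \<in> Poly_Mapping.keys c" for p
    using that assms f_simps(1) by (cases p) (auto simp: keys_frag_of)
  then show ?thesis
    unfolding extend_right_def carrier_free_Abelian_group_iff
    by (intro order_trans[OF keys_frag_extend] UN_least)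
qed

text \<open>A linear \<open>f\<close> carries each relator to a relator of the same kind, so
  \<open>1 \<otimes> f\<close> is well defined on classes.\<close>

lemma extend_right_T: "c \<in> N.T \<Longrightarrow> extend_right f c \<in> N'.T"
proof (induction c rule: N.T_induct)
  case (diff a b)
  then show ?case by (simp add: N'.T_diff)
qed (simp_all add: f_simps N'.T_add_left N'.T_add_right N'.T_smult)

text \<open>Naturality of \<open>l \<otimes> 1\<close> in the second factor. Both sides are
  additive, and on generators it is \<open>f (l x \<odot> y) = l x \<odot> f y\<close>.\<close>

lemma contraction_extend_right:
  assumes l: "l \<in> linear_forms R M" and c: "c \<in> carrier N.F"
  shows "N'.contraction l (extend_right f c) = f (N.contraction l c)"
proof -
  have modules: "module R N" "module R N'" by unfold_locales
  have "Poly_Mapping.keys c \<subseteq> carrier M \<times> carrier N" using c by simp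
  then show ?thesis
  proof (induction c rule: free_Abelian_group_induct[consumes 1, case_names zero diff one])
    case zero
    then show ?case
      by (simp add: N.contraction_zero[OF l] N'.contraction_zero[OF l] linear_map_zero_minus(1)[OF f modules])
  next
    case (diff c d)
    then have cl: "c \<in> carrier N.F" "d \<in> carrier N.F" by simp_all
    have "N'.contraction l (extend_right f (c - d)) =
        N'.contraction l (extend_right f c) \<ominus>\<^bsub>N'\<^esub> N'.contraction l (extend_right f d)"
      by (simp only: extend_right_simps N'.contraction_diff[OF l extend_right_F[OF cl(1)] extend_right_F[OF cl(2)]])
    also have "\<dots> = f (N.contraction l c) \<ominus>\<^bsub>N'\<^esub> f (N.contraction l d)"
      by (simp only: diff(3,4))
    also have "\<dots> = f (N.contraction l (c - d))"
      by (simp only: N.contraction_diff[OF l cl] linear_map_zero_minus(2)[OF f modules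
            N.contraction_closed[OF l cl(1)] N.contraction_closed[OF l cl(2)]])
    finally show ?case .
  next
    case (one p)
    then show ?case
      using linear_formsD(1)[OF l]
      by (cases p) (simp add: N.contraction(2)[OF l] N'.contraction(2)[OF l] f_simps)
  qed
qed

text \<open>Members of one coset differ by elements of \<open>T\<close>, which
  \<open>extend_right f\<close> keeps in the relations; hence \<open>the_elem\<close> is applied to
  a singleton.\<close>

lemma tensor_map_coset:
  assumes c: "c \<in> carrier N.F"
  shows "tensor_map R M N' f (N.T #>\<^bsub>N.F\<^esub> c) = N'.T #>\<^bsub>N'.F\<^esub> extend_right f c"
proof -
  have "N'.T #>\<^bsub>N'.F\<^esub> extend_right f (t + c) = N'.T #>\<^bsub>N'.F\<^esub> extend_right f c" if "t \<in> N.T" for t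
  proof -
    have "t + c \<in> carrier N.F"
      using that c N.T_subset[OF that] keys_add[of t c] by auto
    then show ?thesis
      using extend_right_T[OF that] by (simp only: N'.coset_eq_iff extend_right_F c) simp
  qed
  then have "(\<lambda>d. N'.T #>\<^bsub>N'.F\<^esub> extend_right f d) ` (N.T #>\<^bsub>N.F\<^esub> c) = {N'.T #>\<^bsub>N'.F\<^esub> extend_right f c}"
    using N.T_zero unfolding r_coset_def mult_free_Abelian_group by blast
  then show ?thesis
    by (simp add: tensor_map_def extend_right_def)
qed

end

text \<open>Image and kernel both consist of cosets of elements of the middle free abelian group, so
  they can be compared on representatives. This keeps cosets out of the flatness argument.\<close>

lemma tensor_exact_iff:
  assumes "tensor_pair_map R M N1 N2 f" "tensor_pair_map R M N2 N3 g"
  shows "tensor_map R M N2 f ` carrier (tensor_product R M N1) =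
      kernel (tensor_product R M N2) (tensor_product R M N3) (tensor_map R M N3 g) \<longleftrightarrow>
    (\<forall>c\<in>carrier (free_Abelian_group (carrier M \<times> carrier N2)).
      (\<exists>d\<in>carrier (free_Abelian_group (carrier M \<times> carrier N1)).
        c - extend_right f d \<in> tensor_subgroup R M N2) \<longleftrightarrow>
      extend_right g c \<in> tensor_subgroup R M N3)"
    (is "?A = ?B \<longleftrightarrow> _")
proof -
  interpret f: tensor_pair_map R M N1 N2 f by fact
  interpret g: tensor_pair_map R M N2 N3 g by fact
  have A: "?A = (\<lambda>d. f.N'.T #>\<^bsub>f.N'.F\<^esub> extend_right f d) ` carrier f.N.F"
    unfolding f.N.carrier_tensor_product image_image by (intro image_cong refl f.tensor_map_coset)
  have AB: "?A \<subseteq> carrier (tensor_product R M N2)" "?B \<subseteq> carrier (tensor_product R M N2)"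
    unfolding A kernel_def f.N'.carrier_tensor_product using f.extend_right_F by blast+
  have memA: "f.N'.T #>\<^bsub>f.N'.F\<^esub> c \<in> ?A \<longleftrightarrow> (\<exists>d\<in>carrier f.N.F. c - extend_right f d \<in> f.N'.T)"
    if "c \<in> carrier f.N'.F" for c
    unfolding A image_iff using f.N'.coset_eq_iff[OF that f.extend_right_F] by blast
  have memB: "f.N'.T #>\<^bsub>f.N'.F\<^esub> c \<in> ?B \<longleftrightarrow> extend_right g c \<in> g.N'.T"
    if c: "c \<in> carrier f.N'.F" for c
  proof -
    have "f.N'.T #>\<^bsub>f.N'.F\<^esub> c \<in> ?B \<longleftrightarrow> g.N'.T #>\<^bsub>g.N'.F\<^esub> extend_right g c = g.N'.T #>\<^bsub>g.N'.F\<^esub> 0"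
      unfolding kernel_def g.N'.one_tensor_product g.N'.coset_zero
      using c g.tensor_map_coset[OF c] f.N'.carrier_tensor_product by auto
    also have "\<dots> \<longleftrightarrow> extend_right g c \<in> g.N'.T"
      using g.N'.coset_eq_iff[OF g.extend_right_F[OF c], of 0] by simp
    finally show ?thesis .
  qed
  have "?A = ?B \<longleftrightarrow> (\<forall>C\<in>carrier (tensor_product R M N2). C \<in> ?A \<longleftrightarrow> C \<in> ?B)"
    using AB by blast
  also have "\<dots> \<longleftrightarrow> (\<forall>c\<in>carrier f.N'.F. f.N'.T #>\<^bsub>f.N'.F\<^esub> c \<in> ?A \<longleftrightarrow> f.N'.T #>\<^bsub>f.N'.F\<^esub> c \<in> ?B)"
    unfolding f.N'.carrier_tensor_product by (simp only: ball_simps)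
  also have "\<dots> \<longleftrightarrow> (\<forall>c\<in>carrier f.N'.F.
      (\<exists>d\<in>carrier f.N.F. c - extend_right f d \<in> f.N'.T) \<longleftrightarrow> extend_right g c \<in> g.N'.T)"
    by (intro ball_cong refl) (simp only: memA memB)
  finally show ?thesis .
qed

text \<open>Modules with finite dual systems on every finite subset are the locally projective ones.\<close>

theorem faithfully_flat_module_if_locally_projective:
  fixes M :: "('r, 'a, 'm) module_scheme"
  assumes M: "module R M"
    and dual: "\<And>K. \<lbrakk>finite K; K \<subseteq> carrier M\<rbrakk> \<Longrightarrow> \<exists>(n::nat) b l.
      (\<forall>i<n. b i \<in> carrier M \<and> l i \<in> linear_forms R M) \<and>
      (\<forall>x\<in>K. x = (\<Oplus>\<^bsub>M\<^esub>i\<in>{..<n}. l i x \<odot>\<^bsub>M\<^esub> b i))"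
    and e: "e \<in> carrier M" "\<epsilon> \<in> linear_forms R M" "\<epsilon> e = \<one>\<^bsub>R\<^esub>"
  shows "faithfully_flat_module TYPE('n1) TYPE('n2) TYPE('n3) R M"
  unfolding faithfully_flat_module_def
proof (intro conjI allI impI M)
  fix N1 :: "('r, 'n1) module" and N2 :: "('r, 'n2) module" and N3 :: "('r, 'n3) module" and f g
  assume N: "module R N1" "module R N2" "module R N3"
    and fg: "f \<in> linear_maps R N1 N2" "g \<in> linear_maps R N2 N3"
  note pairs = tensor_pair.intro[OF M N(1)] tensor_pair.intro[OF M N(2)] tensor_pair.intro[OF M N(3)]
  note maps = tensor_pair_map.intro[OF pairs(1,2) tensor_pair_map_axioms.intro[OF fg(1)]]
    tensor_pair_map.intro[OF pairs(2,3) tensor_pair_map_axioms.intro[OF fg(2)]]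
  interpret f: tensor_pair_map R M N1 N2 f by (rule maps)
  interpret g: tensor_pair_map R M N2 N3 g by (rule maps)
  have ker: "a_kernel N2 N3 g = {y \<in> carrier N2. g y = \<zero>\<^bsub>N3\<^esub>}"
    by (simp add: a_kernel_def')
  \<comment> \<open>\<open>\<epsilon> \<otimes> 1\<close> is a left inverse of
    \<open>y \<mapsto> e \<otimes> y\<close>; reflection of exactness rests on this.\<close>
  have contr_e: "f.N'.contraction \<epsilon> (frag_of (e, y)) = y" if "y \<in> carrier N2" for y
    using that e by (simp add: f.N'.contraction(2))
  show "f ` carrier N1 = a_kernel N2 N3 g \<longleftrightarrow>
      tensor_map R M N2 f ` carrier (tensor_product R M N1) =
        kernel (tensor_product R M N2) (tensor_product R M N3) (tensor_map R M N3 g)"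
    unfolding tensor_exact_iff[OF maps]
  proof (intro iffI ballI)
    \<comment> \<open>The image lies in the kernel since \<open>g \<circ> f\<close> vanishes on
      \<open>carrier N1\<close>.\<close>
    fix c assume exact: "f ` carrier N1 = a_kernel N2 N3 g" and c: "c \<in> carrier f.N'.F"
      and "\<exists>d\<in>carrier f.N.F. c - extend_right f d \<in> f.N'.T"
    then obtain d where d: "d \<in> carrier f.N.F" "c - extend_right f d \<in> f.N'.T" by blast
    have gf: "g (f x) = \<zero>\<^bsub>N3\<^esub>" if "x \<in> carrier N1" for x
      using exact that unfolding ker by blast
    have "extend_right g (extend_right f d) \<in> g.N'.T"
    proof -
      have "Poly_Mapping.keys d \<subseteq> carrier M \<times> carrier N1" using d by simp
      then show ?thesis
      proof (induction d rule: free_Abelian_group_induct[consumes 1, case_names zero diff one])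
        case (one p)
        then show ?case by (cases p) (simp add: gf g.N'.T_zero_right)
      qed (simp_all add: g.N'.T_diff)
    qed
    moreover have "extend_right g c - extend_right g (extend_right f d) \<in> g.N'.T"
      using g.extend_right_T[OF d(2)] by simp
    ultimately show "extend_right g c \<in> g.N'.T"
      using g.N'.T_add by fastforce
  next
    fix c assume exact: "f ` carrier N1 = a_kernel N2 N3 g" and c: "c \<in> carrier f.N'.F"
      and gc: "extend_right g c \<in> g.N'.T"
    \<comment> \<open>Only the finitely many first components occurring in \<open>c\<close> have to
      be expanded.\<close>
    define K where "K = fst ` Poly_Mapping.keys c"
    have K: "finite K" "K \<subseteq> carrier M" and cK: "Poly_Mapping.keys c \<subseteq> K \<times> carrier N2"
      using c by (force simp: K_def)+
    obtain n :: nat and b l where b: "\<And>i. i < n \<Longrightarrow> b i \<in> carrier M"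
      and l: "\<And>i. i < n \<Longrightarrow> l i \<in> linear_forms R M"
      and Kbl: "\<And>x. x \<in> K \<Longrightarrow> x = (\<Oplus>\<^bsub>M\<^esub>i\<in>{..<n}. l i x \<odot>\<^bsub>M\<^esub> b i)"
      using dual[OF K] by blast
    \<comment> \<open>By naturality \<open>g\<close> kills each coefficient
      \<open>(l i \<otimes> 1) c\<close>, so exactness supplies a preimage under
      \<open>f\<close>.\<close>
    have "f.N'.contraction (l i) c \<in> f ` carrier N1" if i: "i < n" for i
    proof -
      have "g (f.N'.contraction (l i) c) = \<zero>\<^bsub>N3\<^esub>"
        using g.contraction_extend_right[OF l[OF i] c] g.N'.contraction_T[OF l[OF i] gc] by simp
      then show ?thesis
        unfolding exact ker using f.N'.contraction_closed[OF l[OF i] c] by blast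
    qed
    then have "\<forall>i. \<exists>x. i < n \<longrightarrow> x \<in> carrier N1 \<and> f.N'.contraction (l i) c = f x" by blast
    then obtain x where x: "\<And>i. i < n \<Longrightarrow> x i \<in> carrier N1"
      "\<And>i. i < n \<Longrightarrow> f.N'.contraction (l i) c = f (x i)" by metis
    \<comment> \<open>The expansion of \<open>c\<close> with every coefficient replaced by its
      preimage.\<close>
    define d where "d = (\<Sum>i<n. frag_of (b i, x i))"
    have "d \<in> carrier f.N.F"
      unfolding d_def using b x by (intro sum_closed_free_Abelian_group) simp
    moreover have "extend_right f d = (\<Sum>i<n. frag_of (b i, f.N'.contraction (l i) c))"
      unfolding d_def extend_right_sum using x(2) by (intro sum.cong) simp_all
    ultimately show "\<exists>d\<in>carrier f.N.F. c - extend_right f d \<in> f.N'.T"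
      using f.N'.contraction_expansion[OF b l K(2) Kbl cK] by (intro bexI[of _ d]) simp_all
  next
    assume exact: "\<forall>c\<in>carrier f.N'.F. (\<exists>d\<in>carrier f.N.F. c - extend_right f d \<in> f.N'.T) \<longleftrightarrow>
      extend_right g c \<in> g.N'.T"
    show "f ` carrier N1 = a_kernel N2 N3 g"
      unfolding ker
    proof (intro equalityI subsetI CollectI conjI)
      fix y assume "y \<in> f ` carrier N1"
      then obtain x where x: "x \<in> carrier N1" "y = f x" by blast
      then show y: "y \<in> carrier N2" using f.f_simps(1) by simp
      \<comment> \<open>Exactness after tensoring is tested on \<open>e \<otimes> f x\<close>, and
        \<open>\<epsilon> \<otimes> 1\<close> brings the result back to \<open>N3\<close>.\<close>
      have "frag_of (e, x) \<in> carrier f.N.F" "frag_of (e, y) - extend_right f (frag_of (e, x)) \<in> f.N'.T"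
        using e x by simp_all
      then have "extend_right g (frag_of (e, y)) \<in> g.N'.T"
        using exact f.N'.F_frag[OF e(1) y] by blast
      then show "g y = \<zero>\<^bsub>N3\<^esub>"
        using g.contraction_extend_right[OF e(2) f.N'.F_frag[OF e(1) y]] g.N'.contraction_T[OF e(2)]
          contr_e[OF y] by simp
    next
      fix y assume "y \<in> {y \<in> carrier N2. g y = \<zero>\<^bsub>N3\<^esub>}"
      then have y: "y \<in> carrier N2" "g y = \<zero>\<^bsub>N3\<^esub>" by auto
      note ey = f.N'.F_frag[OF e(1) y(1)]
      \<comment> \<open>\<open>e \<otimes> y\<close> dies under \<open>1 \<otimes> g\<close>, hence
        comes from some \<open>d\<close>; then \<open>(\<epsilon> \<otimes> 1) d\<close> is the
        preimage of \<open>y\<close>.\<close>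
      have "extend_right g (frag_of (e, y)) \<in> g.N'.T"
        using y g.N'.T_zero_right[OF e(1)] by simp
      then obtain d where d: "d \<in> carrier f.N.F" "frag_of (e, y) - extend_right f d \<in> f.N'.T"
        using exact ey by blast
      have cl: "extend_right f d \<in> carrier f.N'.F" using d(1) by (rule f.extend_right_F)
      have "y \<ominus>\<^bsub>N2\<^esub> f.N'.contraction \<epsilon> (extend_right f d) = \<zero>\<^bsub>N2\<^esub>"
        using f.N'.contraction_T[OF e(2) d(2)] f.N'.contraction_diff[OF e(2) ey cl] contr_e[OF y(1)] by simp
      then have "y = f.N'.contraction \<epsilon> (extend_right f d)"
        using f.N'.minus_eq_zeroD[OF _ y(1) f.N'.contraction_closed[OF e(2) cl]] by blast
      also have "\<dots> = f (f.N.contraction \<epsilon> d)"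
        by (rule f.contraction_extend_right[OF e(2) d(1)])
      finally show "y \<in> f ` carrier N1"
        using f.N.contraction_closed[OF e(2) d(1)] by blast
    qed
  qed
qed

section \<open>Maximal ideals and the set \<open>Sigma_T1\<close>\<close>

text \<open>Zorn's lemma on the proper ideals above \<open>I\<close>. Properness is written as
  \<open>\<one> \<notin> J\<close>, which passes to unions of chains.\<close>

lemma (in cring) exists_maximalideal:
  assumes "ideal I R" "I \<noteq> carrier R"
  obtains N where "maximalideal N R" "I \<subseteq> N"
proof -
  interpret I: ideal I R by fact
  define \<A> where "\<A> = {J. ideal J R \<and> I \<subseteq> J \<and> \<one> \<notin> J}"
  have "\<A> \<noteq> {}"
    using assms I.one_imp_carrier unfolding \<A>_def by blast
  moreover have "\<Union>C \<in> \<A>" if C: "C \<noteq> {}" "subset.chain \<A> C" for C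
  proof -
    have "C \<subseteq> \<A>" "subset.chain {J. ideal J R} C"
      using C(2) unfolding \<A>_def pred_on.chain_def by auto
    moreover have "ideal (\<Union>C) R"
      using chain_Union_is_ideal[OF calculation(2)] C(1) by simp
    ultimately show ?thesis
      using C(1) unfolding \<A>_def by blast
  qed
  ultimately obtain N where N: "N \<in> \<A>" and max: "\<And>J. \<lbrakk>J \<in> \<A>; N \<subseteq> J\<rbrakk> \<Longrightarrow> J = N"
    using subset_Zorn_nonempty[of \<A>] by blast
  interpret N: ideal N R using N unfolding \<A>_def by blast
  have "maximalideal N R"
  proof (rule maximalidealI)
    show "ideal N R" by (rule N.is_ideal)
    show "carrier R \<noteq> N" using N unfolding \<A>_def by auto
  next
    fix J assume J: "ideal J R" "N \<subseteq> J" "J \<subseteq> carrier R"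
    show "J = N \<or> J = carrier R"
    proof (cases "\<one> \<in> J")
      case True
      then show ?thesis using ideal.one_imp_carrier[OF J(1)] by simp
    next
      case False
      then have "J \<in> \<A>" using N J unfolding \<A>_def by blast
      then show ?thesis using max J(2) by blast
    qed
  qed
  then show thesis using that N unfolding \<A>_def by blast
qed

text \<open>A nonunit generates a proper ideal, and this lies in a maximal one.\<close>

lemma (in cring) unit_if_notin_maximalideals:
  assumes "a \<in> carrier R" "\<And>N. maximalideal N R \<Longrightarrow> a \<notin> N"
  shows "a \<in> Units R"
proof (rule ccontr)
  assume a: "a \<notin> Units R"
  have "\<one> \<notin> PIdl a"
  proof
    assume "\<one> \<in> PIdl a"
    then obtain b where "b \<in> carrier R" "\<one> = b \<otimes> a" by (auto simp: cgenideal_def)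
    then have "a \<in> Units R"
      using assms(1) m_comm unfolding Units_def by auto
    with a show False by simp
  qed
  then have "PIdl a \<noteq> carrier R" by auto
  then obtain N where "maximalideal N R" "PIdl a \<subseteq> N"
    using exists_maximalideal[OF cgenideal_ideal[OF assms(1)]] by blast
  then show False
    using cgenideal_self[OF assms(1)] assms(2) by blast
qed

section \<open>Sums in ideals and units of quotient rings\<close>

lemma (in ideal) finsum_mem:
  assumes "finite A" "\<And>k. k \<in> A \<Longrightarrow> f k \<in> I"
  shows "(\<Oplus>k\<in>A. f k) \<in> I"
  using assms
proof (induction A rule: finite_induct)
  case (insert k A)
  then have "f \<in> A \<rightarrow> carrier R" "f k \<in> carrier R" using a_subset by auto
  then show ?case using insert by simp
qed simp

text \<open>The other terms may be subtracted. Applied to a coefficient of a product of polynomials,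
  this isolates the product of the leading coefficients modulo \<open>M\<close>.\<close>

lemma (in ideal) mem_if_finsum_mem:
  assumes "finite A" "j \<in> A" "\<And>k. k \<in> A \<Longrightarrow> f k \<in> carrier R"
    and "\<And>k. \<lbrakk>k \<in> A; k \<noteq> j\<rbrakk> \<Longrightarrow> f k \<in> I" and "(\<Oplus>k\<in>A. f k) \<in> I"
  shows "f j \<in> I"
proof -
  define s where "s = (\<Oplus>k\<in>A - {j}. f k)"
  have "(\<Oplus>k\<in>insert j (A - {j}). f k) = f j \<oplus> s"
    unfolding s_def using assms(1-3) by (intro finsum_insert) auto
  then have *: "f j \<oplus> s \<in> I" using assms(2,5) by (simp add: insert_absorb)
  have s: "s \<in> I" unfolding s_def using assms(1,4) by (intro finsum_mem) auto
  have "(f j \<oplus> s) \<oplus> \<ominus> s \<in> I" using additive_subgroup.a_closed[OF is_additive_subgroup * additive_subgroup.a_inv_closed[OF is_additive_subgroup s]] .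
  moreover have "(f j \<oplus> s) \<oplus> \<ominus> s = f j"
    using assms(2,3) a_Hcarr[OF s] by (simp add: a_assoc r_neg)
  ultimately show ?thesis by simp
qed

lemma (in cring) unit_Quot:
  assumes I: "ideal I R" and p: "p \<in> carrier R" and q: "q \<in> carrier R" and pq: "p \<otimes> q \<ominus> \<one> \<in> I"
  shows "I +> p \<in> Units (R Quot I)"
proof -
  interpret I: ideal I R by fact
  interpret Q: cring "R Quot I" by (rule I.quotient_is_cring[OF is_cring])
  have hom: "(+>) I \<in> ring_hom R (R Quot I)" by (rule I.rcos_ring_hom)
  have cl: "I +> p \<in> carrier (R Quot I)" "I +> q \<in> carrier (R Quot I)"
    using ring_hom_closed[OF hom] p q by blast+
  have "(I +> p) \<otimes>\<^bsub>R Quot I\<^esub> (I +> q) = I +> (p \<otimes> q)"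
    using ring_hom_mult[OF hom p q] by simp
  also have "\<dots> = I +> \<one>"
    using quotient_eq_iff_same_a_r_cos[OF I _ one_closed] p q pq by blast
  also have "\<dots> = \<one>\<^bsub>R Quot I\<^esub>" by (rule ring_hom_one[OF hom])
  finally have 1: "(I +> p) \<otimes>\<^bsub>R Quot I\<^esub> (I +> q) = \<one>\<^bsub>R Quot I\<^esub>" .
  moreover have "(I +> q) \<otimes>\<^bsub>R Quot I\<^esub> (I +> p) = \<one>\<^bsub>R Quot I\<^esub>"
    using 1 Q.m_comm[OF cl] by simp
  ultimately show ?thesis unfolding Units_def using cl by blast
qed

section \<open>Ideals of \<open>R[X]\<close> described by coefficients\<close>

context UP_cring
begin

lemma coeff_monom_mult_if:
  assumes "a \<in> carrier R" "p \<in> carrier P"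
  shows "up_ring.coeff P (up_ring.monom P a n \<otimes>\<^bsub>P\<^esub> p) k = (if k < n then \<zero> else a \<otimes> up_ring.coeff P p (k - n))"
proof (cases "k < n")
  case True
  have "(\<Oplus>i\<in>{..k}. up_ring.coeff P (up_ring.monom P a n) i \<otimes> up_ring.coeff P p (k - i)) = \<zero>"
    by (rule R.add.finprod_one_eqI) (use True assms in auto)
  then show ?thesis using True assms by simp
next
  case False
  then show ?thesis using coeff_monom_mult[OF assms, of n "k - n"] by (simp del: coeff_mult)
qed

lemma ideal_UPI:
  assumes "\<And>p. p \<in> I \<Longrightarrow> p \<in> carrier P" "\<zero>\<^bsub>P\<^esub> \<in> I"
    and "\<And>p q. \<lbrakk>p \<in> I; q \<in> I\<rbrakk> \<Longrightarrow> p \<ominus>\<^bsub>P\<^esub> q \<in> I"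
    and "\<And>p q. \<lbrakk>p \<in> I; q \<in> carrier P\<rbrakk> \<Longrightarrow> q \<otimes>\<^bsub>P\<^esub> p \<in> I"
  shows "ideal I P"
proof (rule idealI)
  show "ring P" by (rule P.ring_axioms)
  have neg: "\<ominus>\<^bsub>P\<^esub> p \<in> I" if "p \<in> I" for p
    using assms(3)[OF assms(2) that] assms(1)[OF that] by (simp add: a_minus_def)
  have add: "p \<oplus>\<^bsub>P\<^esub> q \<in> I" if "p \<in> I" "q \<in> I" for p q
    using assms(3)[OF that(1) neg[OF that(2)]] assms(1)[OF that(2)] by (simp add: a_minus_def)
  show "subgroup I (add_monoid P)"
    using assms(1,2) neg add by (intro P.add.subgroupI) (auto simp: a_inv_def[symmetric])
  show "q \<otimes>\<^bsub>P\<^esub> p \<in> I" "p \<otimes>\<^bsub>P\<^esub> q \<in> I" if "p \<in> I" "q \<in> carrier P" for p q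
    using assms(4)[OF that] assms(1)[OF that(1)] that(2) by (simp_all add: P.m_comm)
qed

lemma poly_ideal_eq: "poly_ideal R I = {p \<in> carrier P. \<forall>n. up_ring.coeff P p n \<in> I}"
  by (simp add: poly_ideal_def P_def)

lemma ideal_poly_ideal:
  assumes "ideal I R"
  shows "ideal (poly_ideal R I) P"
proof -
  interpret I: ideal I R by fact
  show ?thesis
    unfolding poly_ideal_eq
  proof (rule ideal_UPI)
    fix p q assume p: "p \<in> {p \<in> carrier P. \<forall>n. up_ring.coeff P p n \<in> I}" and q: "q \<in> carrier P"
    have "(\<Oplus>i\<in>{..n}. up_ring.coeff P q i \<otimes> up_ring.coeff P p (n - i)) \<in> I" for n
      using p q by (intro I.finsum_mem I.I_l_closed) auto
    then show "q \<otimes>\<^bsub>P\<^esub> p \<in> {p \<in> carrier P. \<forall>n. up_ring.coeff P p n \<in> I}"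
      using p q by simp
  next
    fix p q assume "p \<in> {p \<in> carrier P. \<forall>n. up_ring.coeff P p n \<in> I}" "q \<in> {p \<in> carrier P. \<forall>n. up_ring.coeff P p n \<in> I}"
    then show "p \<ominus>\<^bsub>P\<^esub> q \<in> {p \<in> carrier P. \<forall>n. up_ring.coeff P p n \<in> I}"
      by (auto simp: a_minus_def)
  qed auto
qed

text \<open>The ideal generated by \<open>X^n\<close>, given by coefficients so that membership
  needs no cofactor.\<close>

definition low_ideal :: "nat \<Rightarrow> (nat \<Rightarrow> 'a) set"
  where "low_ideal n = {p \<in> carrier P. \<forall>i<n. up_ring.coeff P p i = \<zero>}"

lemma ideal_low_ideal: "ideal (low_ideal n) P"
  unfolding low_ideal_def
proof (rule ideal_UPI)
  fix p q assume p: "p \<in> {p \<in> carrier P. \<forall>i<n. up_ring.coeff P p i = \<zero>}" and q: "q \<in> carrier P"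
  have "(\<Oplus>i\<in>{..k}. up_ring.coeff P q i \<otimes> up_ring.coeff P p (k - i)) = \<zero>" if "k < n" for k
    by (rule R.add.finprod_one_eqI) (use p q that in auto)
  then show "q \<otimes>\<^bsub>P\<^esub> p \<in> {p \<in> carrier P. \<forall>i<n. up_ring.coeff P p i = \<zero>}"
    using p q by simp
qed (auto simp: a_minus_def)

lemma carrier_eq_up: "carrier P = up R"
  by (simp add: P_def UP_def)

lemma coeff_apply: "p \<in> carrier P \<Longrightarrow> up_ring.coeff P p n = p n"
  unfolding carrier_eq_up unfolding P_def UP_def by simp

text \<open>Division by \<open>X\<close> is possible when the constant coefficient vanishes, and it
  only shifts coefficients. In the intersection form the ideal property is immediate.\<close>

lemma X_poly_ideal_eq:
  assumes "ideal I R"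
  shows "X_poly_ideal R I = low_ideal 1 \<inter> poly_ideal R I"
proof (intro equalityI subsetI)
  interpret I: ideal I R by fact
  fix p assume "p \<in> X_poly_ideal R I"
  then obtain q where "q \<in> carrier P" "\<forall>n. up_ring.coeff P q n \<in> I" "p = up_ring.monom P \<one> 1 \<otimes>\<^bsub>P\<^esub> q"
    unfolding X_poly_ideal_def P_def[symmetric] poly_ideal_eq by blast
  then show "p \<in> low_ideal 1 \<inter> poly_ideal R I"
    by (auto simp: low_ideal_def poly_ideal_eq coeff_monom_mult_if simp del: coeff_mult)
next
  fix p assume "p \<in> low_ideal 1 \<inter> poly_ideal R I"
  then have p: "p \<in> carrier P" "up_ring.coeff P p 0 = \<zero>" "\<And>n. up_ring.coeff P p n \<in> I"
    by (auto simp: low_ideal_def poly_ideal_eq)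
  \<comment> \<open>The quotient of \<open>p\<close> by \<open>X\<close>.\<close>
  define q where "q = (\<lambda>n. p (Suc n))"
  have pup: "p \<in> up R" using p(1) by (simp only: carrier_eq_up)
  then obtain n where "bound \<zero> n p" by auto
  then have "bound \<zero> n q" unfolding q_def by (intro bound.intro) (auto simp: bound_def)
  moreover have "q i \<in> carrier R" for i unfolding q_def using pup by (rule mem_upD)
  ultimately have qup: "q \<in> up R" by (intro mem_upI exI)
  then have q: "q \<in> carrier P" by (simp only: carrier_eq_up)
  have coeff_q: "up_ring.coeff P q n = up_ring.coeff P p (Suc n)" for n
    unfolding coeff_apply[OF p(1)] coeff_apply[OF q] by (simp only: q_def)
  have "p = up_ring.monom P \<one> 1 \<otimes>\<^bsub>P\<^esub> q"
  proof (rule up_eqI)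
    show "up_ring.coeff P p n = up_ring.coeff P (up_ring.monom P \<one> 1 \<otimes>\<^bsub>P\<^esub> q) n" for n
      using p q by (cases n) (simp_all add: coeff_monom_mult_if coeff_q del: coeff_mult)
  qed (use p q in simp_all)
  moreover have "q \<in> poly_ideal R I"
    using q p(3) by (simp add: poly_ideal_eq coeff_q)
  ultimately show "p \<in> X_poly_ideal R I"
    unfolding X_poly_ideal_def P_def[symmetric] by blast
qed

section \<open>Members of \<open>Sigma_T1 R\<close> modulo maximal ideals of
  \<open>R\<close>\<close>

lemma const_poly_eq: "const_poly R a = up_ring.monom P a 0"
  by (simp add: const_poly_def P_def)

lemma const_poly_hom: "const_poly R \<in> ring_hom R P"
proof -
  have "const_poly R = (\<lambda>a. up_ring.monom P a 0)" by (rule ext) (rule const_poly_eq)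
  then show ?thesis using const_ring_hom by simp
qed

text \<open>Any maximal ideal \<open>N\<close> above \<open>I\<close> will do: its contraction
  contains \<open>M\<close> and omits \<open>\<one>\<close>, so it is \<open>M\<close> by
  maximality.\<close>

lemma maximal_over_contraction:
  assumes M: "maximalideal M R" and I: "ideal I P" "I \<noteq> carrier P" "poly_ideal R M \<subseteq> I"
  obtains N where "N \<in> T1 R" "I \<subseteq> N"
proof -
  interpret M: maximalideal M R by fact
  obtain N where N: "maximalideal N P" "I \<subseteq> N"
    using P.exists_maximalideal[OF I(1,2)] by blast
  interpret N: maximalideal N P by fact
  have "ring_hom_ring R P (const_poly R)"
    by (intro ring_hom_ringI2 const_poly_hom) unfold_locales
  then have "ideal {a \<in> carrier R. const_poly R a \<in> N} R"
    by (rule ring_hom_ring.ideal_vimage) (rule N.is_ideal)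
  then have ideal: "ideal (poly_contraction R N) R" by (simp add: poly_contraction_def)
  have "const_poly R a \<in> poly_ideal R M" if "a \<in> M" for a
    using that M.a_Hcarr[OF that] by (simp add: poly_ideal_eq const_poly_eq)
  then have sub: "M \<subseteq> poly_contraction R N"
    unfolding poly_contraction_def using I(3) N(2) M.a_Hcarr by blast
  have "\<one>\<^bsub>P\<^esub> \<notin> N" using N.one_imp_carrier N.I_notcarr by auto
  then have "\<one> \<notin> poly_contraction R N"
    by (simp add: poly_contraction_def const_poly_eq)
  then have "poly_contraction R N \<noteq> carrier R" using R.one_closed by blast
  then have "poly_contraction R N = M"
    using M.I_maximal[OF ideal sub] by (auto simp: poly_contraction_def)
  then have "N \<in> T1 R"
    unfolding T1_def P_def[symmetric] using N M by simp
  then show thesis using that N(2) by blast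
qed

text \<open>If \<open>M[X] + (f)\<close> were proper, it would lie in a member of
  \<open>T1 R\<close>, which would contain \<open>f\<close>. Hence \<open>1 = k + q f\<close> with
  \<open>k\<close> in \<open>M[X]\<close>; what is kept is that \<open>q f\<close> is a nonzero
  constant modulo \<open>M\<close>.\<close>

lemma Sigma_T1_inverse_mod:
  assumes M: "maximalideal M R" and f: "f \<in> Sigma_T1 R"
  obtains q where "q \<in> carrier P" "\<And>n. n > 0 \<Longrightarrow> up_ring.coeff P (q \<otimes>\<^bsub>P\<^esub> f) n \<in> M" "up_ring.coeff P (q \<otimes>\<^bsub>P\<^esub> f) 0 \<notin> M"
proof -
  interpret M: maximalideal M R by fact
  have fP: "f \<in> carrier P" and fT1: "\<And>N. N \<in> T1 R \<Longrightarrow> f \<notin> N"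
    using f by (auto simp: Sigma_T1_def P_def)
  interpret K: ideal "poly_ideal R M" P by (rule ideal_poly_ideal[OF M.is_ideal])
  interpret F: ideal "PIdl\<^bsub>P\<^esub> f" P by (rule P.cgenideal_ideal[OF fP])
  define J where "J = poly_ideal R M <+>\<^bsub>P\<^esub> PIdl\<^bsub>P\<^esub> f"
  have J: "ideal J P" unfolding J_def by (rule P.add_ideals[OF K.is_ideal F.is_ideal])
  have J_mem: "k \<oplus>\<^bsub>P\<^esub> x \<in> J" if "k \<in> poly_ideal R M" "x \<in> PIdl\<^bsub>P\<^esub> f" for k x
    using that unfolding J_def set_add_def' by blast
  have KJ: "poly_ideal R M \<subseteq> J"
  proof
    fix k assume "k \<in> poly_ideal R M"
    then show "k \<in> J" using J_mem[of k "\<zero>\<^bsub>P\<^esub>"] K.a_Hcarr by simp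
  qed
  have fJ: "f \<in> J"
    using J_mem[of "\<zero>\<^bsub>P\<^esub>" f] P.cgenideal_self[OF fP] fP by simp
  have "J = carrier P"
  proof (rule ccontr)
    assume "J \<noteq> carrier P"
    then obtain N where "N \<in> T1 R" "J \<subseteq> N" by (rule maximal_over_contraction[OF M J _ KJ])
    then show False using fJ fT1 by blast
  qed
  then obtain k x where k: "k \<in> poly_ideal R M" "x \<in> PIdl\<^bsub>P\<^esub> f" "\<one>\<^bsub>P\<^esub> = k \<oplus>\<^bsub>P\<^esub> x"
    using P.one_closed unfolding J_def set_add_def' by blast
  from k(2) obtain q where q: "q \<in> carrier P" "x = q \<otimes>\<^bsub>P\<^esub> f"
    unfolding cgenideal_def by blast
  have kP: "k \<in> carrier P" and kM: "up_ring.coeff P k n \<in> M" for n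
    using k(1) unfolding poly_ideal_eq by blast+
  have xP: "x \<in> carrier P" unfolding q(2) using q(1) fP by (rule UP_mult_closed)
  have one: "up_ring.coeff P k n \<oplus> up_ring.coeff P x n = (if n = 0 then \<one> else \<zero>)" for n
    using arg_cong[OF k(3), of "\<lambda>p. up_ring.coeff P p n"]
    unfolding coeff_add[OF kP xP] coeff_one by (rule sym)
  have "up_ring.coeff P x n \<in> M" if "n > 0" for n
  proof -
    have "up_ring.coeff P x n \<oplus> up_ring.coeff P k n = \<zero>"
      using one[of n] that R.a_comm[OF coeff_closed[OF xP] coeff_closed[OF kP]] by simp
    then have "\<ominus> up_ring.coeff P k n = up_ring.coeff P x n"
      using coeff_closed[OF kP] coeff_closed[OF xP] by (rule R.minus_equality)
    then show ?thesis
      using additive_subgroup.a_inv_closed[OF M.is_additive_subgroup kM[of n]] by simp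
  qed
  moreover have "up_ring.coeff P x 0 \<notin> M"
  proof
    assume "up_ring.coeff P x 0 \<in> M"
    then have "up_ring.coeff P k 0 \<oplus> up_ring.coeff P x 0 \<in> M"
      by (rule additive_subgroup.a_closed[OF M.is_additive_subgroup kM])
    then have "\<one> \<in> M" using one[of 0] by simp
    then show False using M.one_imp_carrier M.I_notcarr by simp
  qed
  ultimately show thesis using that[OF q(1)] unfolding q(2) by blast
qed

text \<open>Over the domain \<open>R/M\<close> a factor of a nonzero constant polynomial is itself a
  nonzero constant. The degree argument is carried out on coefficients in \<open>R\<close>.\<close>

lemma Sigma_T1_coeffs_mod:
  assumes M: "maximalideal M R" and f: "f \<in> Sigma_T1 R"
  shows "up_ring.coeff P f 0 \<notin> M" and "i > 0 \<Longrightarrow> up_ring.coeff P f i \<in> M"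
proof -
  interpret M: maximalideal M R by fact
  interpret prime: primeideal M R by (rule R.maximalideal_prime[OF M])
  obtain q where q: "q \<in> carrier P" and qf: "\<And>n. n > 0 \<Longrightarrow> up_ring.coeff P (q \<otimes>\<^bsub>P\<^esub> f) n \<in> M"
    and qf0: "up_ring.coeff P (q \<otimes>\<^bsub>P\<^esub> f) 0 \<notin> M"
    using Sigma_T1_inverse_mod[OF M f] by blast
  have fP: "f \<in> carrier P" using f by (simp add: Sigma_T1_def P_def)
  have qf0': "up_ring.coeff P q 0 \<otimes> up_ring.coeff P f 0 \<notin> M" using qf0 q fP by simp
  show "up_ring.coeff P f 0 \<notin> M" using qf0' M.I_l_closed q by auto
  have q0: "up_ring.coeff P q 0 \<notin> M" using qf0' M.I_r_closed fP by auto
  show "up_ring.coeff P f i \<in> M" if "i > 0"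
  proof (rule ccontr)
    assume fi: "up_ring.coeff P f i \<notin> M"
    have fin: "finite {k. up_ring.coeff P p k \<notin> M}" if p: "p \<in> carrier P" for p
    proof -
      have "k \<le> deg R p" if "up_ring.coeff P p k \<notin> M" for k
        using that deg_aboveD[OF _ p] additive_subgroup.zero_closed[OF M.is_additive_subgroup]
        by (metis not_le)
      then have "{k. up_ring.coeff P p k \<notin> M} \<subseteq> {..deg R p}" by blast
      then show ?thesis using finite_subset by blast
    qed
    \<comment> \<open>The degrees of \<open>f\<close> and \<open>q\<close> modulo \<open>M\<close>;
      the two finite sets are nonempty by \<open>fi\<close> and \<open>q0\<close>.\<close>
    define a b where "a = Max {k. up_ring.coeff P f k \<notin> M}" and "b = Max {k. up_ring.coeff P q k \<notin> M}"
    have a: "up_ring.coeff P f a \<notin> M" "i \<le> a" "\<And>k. a < k \<Longrightarrow> up_ring.coeff P f k \<in> M"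
      using Max_in[OF fin[OF fP]] Max_ge[OF fin[OF fP]] fi unfolding a_def by fastforce+
    have b: "up_ring.coeff P q b \<notin> M" "\<And>k. b < k \<Longrightarrow> up_ring.coeff P q k \<in> M"
      using Max_in[OF fin[OF q]] Max_ge[OF fin[OF q]] q0 unfolding b_def by fastforce+
    \<comment> \<open>In degree \<open>a + b\<close> every other summand has a factor in
      \<open>M\<close>, by the choice of \<open>a\<close> and \<open>b\<close>. The index
      \<open>a + b - b\<close> keeps the form of the convolution sum.\<close>
    have "up_ring.coeff P q b \<otimes> up_ring.coeff P f (a + b - b) \<in> M"
    proof (rule M.mem_if_finsum_mem[where A = "{..a + b}" and j = b
          and f = "\<lambda>k. up_ring.coeff P q k \<otimes> up_ring.coeff P f (a + b - k)"])
      fix k assume "k \<in> {..a + b}" "k \<noteq> b"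
      then consider "b < k" | "a < a + b - k" by fastforce
      then show "up_ring.coeff P q k \<otimes> up_ring.coeff P f (a + b - k) \<in> M"
        by cases (use a b q fP M.I_l_closed M.I_r_closed in auto)
    next
      \<comment> \<open>From \<open>0 < i\<close> and \<open>i \<le> a\<close> the degree
        \<open>a + b\<close> is positive, and there \<open>q f\<close> has its coefficients in
        \<open>M\<close>.\<close>
      show "(\<Oplus>k\<in>{..a + b}. up_ring.coeff P q k \<otimes> up_ring.coeff P f (a + b - k)) \<in> M"
        using qf[of "a + b"] a(2) that q fP by simp
    qed (use q fP in auto)
    then show False
      using prime.I_prime[of "up_ring.coeff P q b" "up_ring.coeff P f a"] a(1) b(1) q fP by auto
  qed
qed

text \<open>The constant coefficient avoids every maximal ideal of \<open>R\<close>.\<close>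

lemma Sigma_T1_coeff_0_unit:
  assumes "f \<in> Sigma_T1 R"
  shows "up_ring.coeff P f 0 \<in> Units R"
  using assms Sigma_T1_coeffs_mod(1)
  by (intro R.unit_if_notin_maximalideals) (auto simp: Sigma_T1_def P_def[symmetric])

text \<open>The complement of a union of prime ideals is multiplicatively closed.\<close>

lemma mult_submonoid_Sigma_T1: "mult_submonoid P (Sigma_T1 R)"
proof -
  show ?thesis
  proof (intro mult_submonoid.intro UP_cring mult_submonoid_axioms.intro)
    show "Sigma_T1 R \<subseteq> carrier P" by (auto simp: Sigma_T1_def P_def)
    have "\<one>\<^bsub>P\<^esub> \<notin> N" if "N \<in> T1 R" for N
    proof -
      interpret N: maximalideal N P using that by (simp add: T1_def P_def)
      show ?thesis using N.one_imp_carrier N.I_notcarr by auto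
    qed
    then show "\<one>\<^bsub>P\<^esub> \<in> Sigma_T1 R" by (auto simp: Sigma_T1_def P_def[symmetric])
    show "f \<otimes>\<^bsub>P\<^esub> g \<in> Sigma_T1 R" if "f \<in> Sigma_T1 R" "g \<in> Sigma_T1 R" for f g
    proof -
      have fg: "f \<in> carrier P" "g \<in> carrier P" "\<And>N. N \<in> T1 R \<Longrightarrow> f \<notin> N" "\<And>N. N \<in> T1 R \<Longrightarrow> g \<notin> N"
        using that by (auto simp: Sigma_T1_def P_def)
      have "f \<otimes>\<^bsub>P\<^esub> g \<notin> N" if "N \<in> T1 R" for N
      proof -
        have "maximalideal N P" using that by (simp add: T1_def P_def)
        then interpret N: primeideal N P by (rule P.maximalideal_prime)
        show ?thesis using N.I_prime fg that by blast
      qed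
      then show ?thesis using fg by (auto simp: Sigma_T1_def P_def[symmetric])
    qed
  qed
qed

end

section \<open>The ring \<open>R{X}\<close>\<close>

lemma module_module_via:
  assumes "cring R" "cring S" "h \<in> ring_hom R S"
  shows "module R (module_via h S)"
proof -
  interpret R: cring R by fact
  interpret S: cring S by fact
  have h: "\<And>r. r \<in> carrier R \<Longrightarrow> h r \<in> carrier S"
    "\<And>r r'. \<lbrakk>r \<in> carrier R; r' \<in> carrier R\<rbrakk> \<Longrightarrow> h (r \<oplus>\<^bsub>R\<^esub> r') = h r \<oplus>\<^bsub>S\<^esub> h r'"
    "\<And>r r'. \<lbrakk>r \<in> carrier R; r' \<in> carrier R\<rbrakk> \<Longrightarrow> h (r \<otimes>\<^bsub>R\<^esub> r') = h r \<otimes>\<^bsub>S\<^esub> h r'"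
    "h \<one>\<^bsub>R\<^esub> = \<one>\<^bsub>S\<^esub>"
    using assms(3) by (auto simp: ring_hom_def)
  have "abelian_group (module_via h S)"
  proof (rule abelian_groupI)
    show "\<exists>y\<in>carrier (module_via h S). y \<oplus>\<^bsub>module_via h S\<^esub> x = \<zero>\<^bsub>module_via h S\<^esub>"
      if "x \<in> carrier (module_via h S)" for x
      using that S.l_neg S.a_inv_closed by (force simp: module_via_def)
  qed (simp_all add: module_via_def S.a_ac)
  then show ?thesis
    by (rule moduleI[OF assms(1)])
      (simp_all add: module_via_def h S.l_distr S.r_distr S.m_assoc)
qed

lemma finsum_module_via: "finsum (module_via h S) f K = finsum S f K"
  by (simp add: finsum_def finprod_def module_via_def)

section \<open>Units modulo \<open>XM[X]\<close> and modulo \<open>X^n\<close>, and the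
  factorization\<close>

context UP_cring
begin

interpretation S: mult_submonoid P "Sigma_T1 R"
  by (rule mult_submonoid_Sigma_T1)

lemma brace_ring_eq: "brace_ring R = S.L"
  by (simp only: brace_ring_def P_def)

lemma to_brace_eq: "to_brace R a = loc_map P (Sigma_T1 R) (const_poly R a)"
  by (simp only: to_brace_def P_def comp_apply)

lemma coeff_const_mult:
  "\<lbrakk>a \<in> carrier R; p \<in> carrier P\<rbrakk> \<Longrightarrow> up_ring.coeff P (const_poly R a \<otimes>\<^bsub>P\<^esub> p) n = a \<otimes> up_ring.coeff P p n"
  unfolding const_poly_eq by (subst coeff_monom_mult_if) simp_all

lemma const_poly_closed: "a \<in> carrier R \<Longrightarrow> const_poly R a \<in> carrier P"
  by (simp add: const_poly_eq)

lemma coeff_minus_one: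
  "p \<in> carrier P \<Longrightarrow> up_ring.coeff P (p \<ominus>\<^bsub>P\<^esub> \<one>\<^bsub>P\<^esub>) n = up_ring.coeff P p n \<ominus> (if n = 0 then \<one> else \<zero>)"
  by simp

lemma ideal_X_poly_ideal: "ideal I R \<Longrightarrow> ideal (X_poly_ideal R I) P"
  unfolding X_poly_ideal_eq by (intro P.i_intersect ideal_low_ideal ideal_poly_ideal)

text \<open>The inverse is the constant \<open>c\<close> inverting the constant coefficient:
  \<open>c f - 1\<close> has no constant term, and its other coefficients lie in
  \<open>M\<close>.\<close>

lemma unit_mod_X_poly_ideal:
  assumes M: "maximalideal M R" and f: "f \<in> Sigma_T1 R"
  shows "X_poly_ideal R M +>\<^bsub>P\<^esub> f \<in> Units (P Quot X_poly_ideal R M)"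
proof -
  interpret M: maximalideal M R by fact
  have fP: "f \<in> carrier P" using f by simp
  define c where "c = inv (up_ring.coeff P f 0)"
  have U: "up_ring.coeff P f 0 \<in> Units R" by (rule Sigma_T1_coeff_0_unit[OF f])
  have c: "c \<in> carrier R" "c \<otimes> up_ring.coeff P f 0 = \<one>"
    unfolding c_def using R.Units_inv_closed[OF U] R.Units_l_inv[OF U] by auto
  have cP: "const_poly R c \<in> carrier P" using c(1) by (rule const_poly_closed)
  define g where "g = const_poly R c \<otimes>\<^bsub>P\<^esub> f \<ominus>\<^bsub>P\<^esub> \<one>\<^bsub>P\<^esub>"
  have gP: "g \<in> carrier P" unfolding g_def using cP fP by simp
  have coeff_g: "up_ring.coeff P g n = c \<otimes> up_ring.coeff P f n \<ominus> (if n = 0 then \<one> else \<zero>)" for n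
    unfolding g_def coeff_minus_one[OF UP_mult_closed[OF cP fP]] coeff_const_mult[OF c(1) fP] by (rule refl)
  have g0: "up_ring.coeff P g 0 = \<zero>"
    unfolding coeff_g c(2) by simp
  have "up_ring.coeff P g n \<in> M" for n
  proof (cases "n = 0")
    case True
    then show ?thesis using g0 additive_subgroup.zero_closed[OF M.is_additive_subgroup] by simp
  next
    case False
    have fn: "up_ring.coeff P f n \<in> M" using Sigma_T1_coeffs_mod(2)[OF M f] False by simp
    have "up_ring.coeff P g n = c \<otimes> up_ring.coeff P f n"
      unfolding coeff_g using False c(1) fP by (simp add: a_minus_def)
    then show ?thesis using M.I_l_closed[OF fn c(1)] by simp
  qed
  then have "g \<in> X_poly_ideal R M"
    unfolding X_poly_ideal_eq[OF M.is_ideal] using gP g0 by (simp add: low_ideal_def poly_ideal_eq)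
  then have "f \<otimes>\<^bsub>P\<^esub> const_poly R c \<ominus>\<^bsub>P\<^esub> \<one>\<^bsub>P\<^esub> \<in> X_poly_ideal R M"
    unfolding g_def UP_m_comm[OF fP cP] .
  then show ?thesis
    by (rule P.unit_Quot[OF ideal_X_poly_ideal[OF M.is_ideal] fP cP])
qed

text \<open>Truncated inversion of a power series: an inverse modulo \<open>X^n\<close> is corrected
  by one monomial of degree \<open>n\<close>.\<close>

lemma inverse_mod_low_ideal:
  assumes fP: "f \<in> carrier P" and U: "up_ring.coeff P f 0 \<in> Units R"
  shows "\<exists>q\<in>carrier P. f \<otimes>\<^bsub>P\<^esub> q \<ominus>\<^bsub>P\<^esub> \<one>\<^bsub>P\<^esub> \<in> low_ideal n"
proof (induction n)
  case 0
  show ?case using fP by (intro bexI[of _ "\<zero>\<^bsub>P\<^esub>"]) (simp_all add: low_ideal_def)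
next
  case (Suc n)
  then obtain q where q: "q \<in> carrier P" and fq: "f \<otimes>\<^bsub>P\<^esub> q \<ominus>\<^bsub>P\<^esub> \<one>\<^bsub>P\<^esub> \<in> low_ideal n" by blast
  define g where "g = f \<otimes>\<^bsub>P\<^esub> q \<ominus>\<^bsub>P\<^esub> \<one>\<^bsub>P\<^esub>"
  have gP: "g \<in> carrier P" unfolding g_def using fP q by simp
  have g_low: "up_ring.coeff P g i = \<zero>" if "i < n" for i
    using fq that unfolding g_def[symmetric] low_ideal_def by blast
  \<comment> \<open>Chosen so that \<open>c X^n f\<close> has the same coefficient in degree
    \<open>n\<close> as the error \<open>g\<close>.\<close>
  define c where "c = up_ring.coeff P g n \<otimes> inv (up_ring.coeff P f 0)"
  have c: "c \<in> carrier R" "c \<otimes> up_ring.coeff P f 0 = up_ring.coeff P g n"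
    unfolding c_def using gP R.Units_inv_closed[OF U] R.Units_l_inv[OF U] coeff_closed[OF fP]
    by (simp_all add: R.m_assoc)
  define h where "h = up_ring.monom P c n"
  have hP: "h \<in> carrier P" unfolding h_def using c(1) by simp
  have coeff_hf: "up_ring.coeff P (h \<otimes>\<^bsub>P\<^esub> f) i = (if i < n then \<zero> else c \<otimes> up_ring.coeff P f (i - n))" for i
    unfolding h_def by (rule coeff_monom_mult_if[OF c(1) fP])
  have eq: "f \<otimes>\<^bsub>P\<^esub> (q \<ominus>\<^bsub>P\<^esub> h) \<ominus>\<^bsub>P\<^esub> \<one>\<^bsub>P\<^esub> = g \<ominus>\<^bsub>P\<^esub> h \<otimes>\<^bsub>P\<^esub> f"
    unfolding g_def using fP q hP
    by (simp add: a_minus_def P.r_distr P.r_minus P.a_ac P.m_comm)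
  have "up_ring.coeff P (g \<ominus>\<^bsub>P\<^esub> h \<otimes>\<^bsub>P\<^esub> f) i = \<zero>" if i: "i < Suc n" for i
  proof -
    have "up_ring.coeff P (g \<ominus>\<^bsub>P\<^esub> h \<otimes>\<^bsub>P\<^esub> f) i = up_ring.coeff P g i \<ominus> up_ring.coeff P (h \<otimes>\<^bsub>P\<^esub> f) i"
      by (rule coeff_minus[OF gP UP_mult_closed[OF hP fP]])
    also have "\<dots> = \<zero>"
      unfolding coeff_hf using i g_low[of i] c coeff_closed[OF gP, of n]
      by (cases "i < n") (auto simp: less_Suc_eq a_minus_def R.r_neg)
    finally show ?thesis .
  qed
  moreover have "g \<ominus>\<^bsub>P\<^esub> h \<otimes>\<^bsub>P\<^esub> f \<in> carrier P" using gP hP fP by simp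
  ultimately have "f \<otimes>\<^bsub>P\<^esub> (q \<ominus>\<^bsub>P\<^esub> h) \<ominus>\<^bsub>P\<^esub> \<one>\<^bsub>P\<^esub> \<in> low_ideal (Suc n)"
    unfolding eq low_ideal_def by blast
  moreover have "q \<ominus>\<^bsub>P\<^esub> h \<in> carrier P" using q hP by simp
  ultimately show ?case by blast
qed

lemma to_brace_hom: "to_brace R \<in> ring_hom R (brace_ring R)"
proof -
  have "to_brace R = loc_map P (Sigma_T1 R) \<circ> const_poly R"
    by (simp only: to_brace_def P_def)
  then show ?thesis
    unfolding brace_ring_eq using ring_hom_trans[OF const_poly_hom S.loc_map_hom] by simp
qed

text \<open>The quotient map from \<open>R[X]\<close> inverts \<open>Sigma_T1 R\<close>, so it
  extends to \<open>R{X}\<close>; the claim is its value on constants.\<close>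

lemma slash_factorization:
  assumes M: "maximalideal M R"
  shows "\<exists>\<phi>\<in>ring_hom (brace_ring R) (slash_ring R M). \<forall>a\<in>carrier R. \<phi> (to_brace R a) = to_slash R M a"
proof -
  interpret M: maximalideal M R by fact
  interpret I: ideal "X_poly_ideal R M" P by (rule ideal_X_poly_ideal[OF M.is_ideal])
  have slash: "slash_ring R M = P Quot X_poly_ideal R M"
    by (simp only: slash_ring_def P_def)
  obtain \<phi> where \<phi>: "\<phi> \<in> ring_hom S.L (P Quot X_poly_ideal R M)"
    "\<And>p. p \<in> carrier P \<Longrightarrow> \<phi> (loc_map P (Sigma_T1 R) p) = X_poly_ideal R M +>\<^bsub>P\<^esub> p"
    by (rule S.localization_lift[OF I.quotient_is_cring[OF UP_cring] I.rcos_ring_hom])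
      (use unit_mod_X_poly_ideal[OF M] in auto)
  have "\<phi> (to_brace R a) = to_slash R M a" if "a \<in> carrier R" for a
    unfolding to_brace_eq \<phi>(2)[OF const_poly_closed[OF that]]
    by (simp only: to_slash_def P_def comp_apply)
  then show ?thesis
    unfolding slash brace_ring_eq using \<phi>(1) by blast
qed

section \<open>Coefficient forms and dual systems on \<open>R{X}\<close>\<close>

abbreviation brace_module where "brace_module \<equiv> module_via (to_brace R) (brace_ring R)"

text \<open>Representatives of a coset differ by multiples of \<open>X^n\<close>, so the choice does
  not affect coefficients below \<open>n\<close>.\<close>

lemma low_ideal_coset_coeff:
  assumes p: "p \<in> carrier P" and j: "j < n"
  shows "up_ring.coeff P (SOME q. q \<in> low_ideal n +>\<^bsub>P\<^esub> p) j = up_ring.coeff P p j"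
proof -
  interpret J: ideal "low_ideal n" P by (rule ideal_low_ideal)
  have "p \<in> low_ideal n +>\<^bsub>P\<^esub> p" by (rule J.a_rcos_self[OF p])
  then have "(SOME q. q \<in> low_ideal n +>\<^bsub>P\<^esub> p) \<in> low_ideal n +>\<^bsub>P\<^esub> p"
    by (rule someI[where P = "\<lambda>q. q \<in> low_ideal n +>\<^bsub>P\<^esub> p"])
  then obtain u where u: "u \<in> low_ideal n" "(SOME q. q \<in> low_ideal n +>\<^bsub>P\<^esub> p) = u \<oplus>\<^bsub>P\<^esub> p"
    unfolding a_r_coset_def' by blast
  have "u \<in> carrier P" "up_ring.coeff P u j = \<zero>"
    using u(1) j unfolding low_ideal_def by blast+
  then show ?thesis unfolding u(2) using p by simp
qed

text \<open>Members of \<open>Sigma_T1 R\<close> are units modulo \<open>X^n\<close>, which gives a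
  ring map \<open>\<psi>\<close> from \<open>R{X}\<close> to \<open>R[X]/(X^n)\<close>. Multiplying
  by \<open>s\<close> before applying it clears the denominator, so the forms read off
  numerators.\<close>

lemma coeff_forms:
  assumes s: "s \<in> Sigma_T1 R"
  obtains l where "\<And>j. j < n \<Longrightarrow> l j \<in> linear_forms R brace_module"
    and "\<And>j p. \<lbrakk>j < n; p \<in> carrier P\<rbrakk> \<Longrightarrow> l j (loc_frac P (Sigma_T1 R) p s) = up_ring.coeff P p j"
proof -
  interpret J: ideal "low_ideal n" P by (rule ideal_low_ideal)
  interpret L: cring S.L by (rule S.cring_localization)
  let ?Q = "P Quot low_ideal n"
  have "low_ideal n +>\<^bsub>P\<^esub> f \<in> Units ?Q" if f: "f \<in> Sigma_T1 R" for f
  proof -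
    have fP: "f \<in> carrier P" using f by (rule S.S_closed)
    obtain q where "q \<in> carrier P" "f \<otimes>\<^bsub>P\<^esub> q \<ominus>\<^bsub>P\<^esub> \<one>\<^bsub>P\<^esub> \<in> low_ideal n"
      using inverse_mod_low_ideal[OF fP Sigma_T1_coeff_0_unit[OF f]] by blast
    then show ?thesis by (rule P.unit_Quot[OF J.is_ideal fP])
  qed
  then obtain \<psi> where \<psi>: "\<psi> \<in> ring_hom S.L ?Q"
    and \<psi>_map: "\<And>p. p \<in> carrier P \<Longrightarrow> \<psi> (loc_map P (Sigma_T1 R) p) = low_ideal n +>\<^bsub>P\<^esub> p"
    using S.localization_lift[OF J.quotient_is_cring[OF UP_cring] J.rcos_ring_hom] by blast
  define \<sigma> where "\<sigma> = loc_map P (Sigma_T1 R) s"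
  have \<sigma>: "\<sigma> \<in> carrier S.L"
    unfolding \<sigma>_def using ring_hom_closed[OF S.loc_map_hom] s by blast
  \<comment> \<open>The coefficient of \<open>X^j\<close> in \<open>\<psi> (s x)\<close>, taken on a
    chosen representative.\<close>
  define l where "l j x = up_ring.coeff P (SOME q. q \<in> \<psi> (\<sigma> \<otimes>\<^bsub>S.L\<^esub> x)) j" for j x
  have l_eq: "l j x = up_ring.coeff P p j" if "j < n" "p \<in> carrier P" "\<psi> (\<sigma> \<otimes>\<^bsub>S.L\<^esub> x) = low_ideal n +>\<^bsub>P\<^esub> p" for j x p
    unfolding l_def that(3) by (rule low_ideal_coset_coeff[OF that(2,1)])
  have rep: "\<exists>p\<in>carrier P. \<psi> (\<sigma> \<otimes>\<^bsub>S.L\<^esub> x) = low_ideal n +>\<^bsub>P\<^esub> p" if x: "x \<in> carrier S.L" for x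
  proof -
    have "\<psi> (\<sigma> \<otimes>\<^bsub>S.L\<^esub> x) \<in> carrier ?Q" by (rule ring_hom_closed[OF \<psi> L.m_closed[OF \<sigma> x]])
    then show ?thesis by (auto simp: FactRing_def A_RCOSETS_def')
  qed
  have "l j \<in> linear_forms R brace_module" if j: "j < n" for j
    unfolding linear_maps_def
  proof (intro CollectI conjI ballI funcsetI)
    fix x assume "x \<in> carrier brace_module"
    then have x: "x \<in> carrier S.L" by (simp add: module_via_def brace_ring_eq)
    obtain p where p: "p \<in> carrier P" "\<psi> (\<sigma> \<otimes>\<^bsub>S.L\<^esub> x) = low_ideal n +>\<^bsub>P\<^esub> p" using rep[OF x] by blast
    show "l j x \<in> carrier (module_via (\<lambda>r. r) R)"
      unfolding l_eq[OF j p] using coeff_closed[OF p(1)] by (simp add: module_via_def)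
    fix y assume "y \<in> carrier brace_module"
    then have y: "y \<in> carrier S.L" by (simp add: module_via_def brace_ring_eq)
    obtain q where q: "q \<in> carrier P" "\<psi> (\<sigma> \<otimes>\<^bsub>S.L\<^esub> y) = low_ideal n +>\<^bsub>P\<^esub> q" using rep[OF y] by blast
    have "\<psi> (\<sigma> \<otimes>\<^bsub>S.L\<^esub> (x \<oplus>\<^bsub>S.L\<^esub> y)) = \<psi> (\<sigma> \<otimes>\<^bsub>S.L\<^esub> x) \<oplus>\<^bsub>?Q\<^esub> \<psi> (\<sigma> \<otimes>\<^bsub>S.L\<^esub> y)"
      unfolding L.r_distr[OF x y \<sigma>] by (rule ring_hom_add[OF \<psi> L.m_closed[OF \<sigma> x] L.m_closed[OF \<sigma> y]])
    also have "\<dots> = low_ideal n +>\<^bsub>P\<^esub> (p \<oplus>\<^bsub>P\<^esub> q)"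
      unfolding p(2) q(2) by (rule ring_hom_add[OF J.rcos_ring_hom p(1) q(1), symmetric])
    finally have "l j (x \<oplus>\<^bsub>S.L\<^esub> y) = up_ring.coeff P (p \<oplus>\<^bsub>P\<^esub> q) j"
      by (rule l_eq[OF j UP_a_closed[OF p(1) q(1)]])
    also have "\<dots> = l j x \<oplus> l j y"
      unfolding l_eq[OF j p] l_eq[OF j q] by (rule coeff_add[OF p(1) q(1)])
    finally show "l j (x \<oplus>\<^bsub>brace_module\<^esub> y) = l j x \<oplus>\<^bsub>module_via (\<lambda>r. r) R\<^esub> l j y"
      by (simp add: module_via_def brace_ring_eq)
  next
    fix r x assume r: "r \<in> carrier R" and "x \<in> carrier brace_module"
    then have x: "x \<in> carrier S.L" by (simp add: module_via_def brace_ring_eq)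
    obtain p where p: "p \<in> carrier P" "\<psi> (\<sigma> \<otimes>\<^bsub>S.L\<^esub> x) = low_ideal n +>\<^bsub>P\<^esub> p" using rep[OF x] by blast
    have rP: "const_poly R r \<in> carrier P" using r by (rule const_poly_closed)
    have tr: "to_brace R r \<in> carrier S.L"
      unfolding to_brace_eq by (rule ring_hom_closed[OF S.loc_map_hom rP])
    have "\<sigma> \<otimes>\<^bsub>S.L\<^esub> (to_brace R r \<otimes>\<^bsub>S.L\<^esub> x) = to_brace R r \<otimes>\<^bsub>S.L\<^esub> (\<sigma> \<otimes>\<^bsub>S.L\<^esub> x)"
      using \<sigma> tr x by (simp add: L.m_lcomm)
    then have "\<psi> (\<sigma> \<otimes>\<^bsub>S.L\<^esub> (to_brace R r \<otimes>\<^bsub>S.L\<^esub> x)) = \<psi> (to_brace R r) \<otimes>\<^bsub>?Q\<^esub> \<psi> (\<sigma> \<otimes>\<^bsub>S.L\<^esub> x)"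
      using ring_hom_mult[OF \<psi> tr L.m_closed[OF \<sigma> x]] by simp
    also have "\<dots> = low_ideal n +>\<^bsub>P\<^esub> (const_poly R r \<otimes>\<^bsub>P\<^esub> p)"
      unfolding p(2) to_brace_eq \<psi>_map[OF rP] by (rule ring_hom_mult[OF J.rcos_ring_hom rP p(1), symmetric])
    finally have "l j (to_brace R r \<otimes>\<^bsub>S.L\<^esub> x) = up_ring.coeff P (const_poly R r \<otimes>\<^bsub>P\<^esub> p) j"
      by (rule l_eq[OF j UP_mult_closed[OF rP p(1)]])
    also have "\<dots> = r \<otimes> l j x"
      unfolding l_eq[OF j p] by (rule coeff_const_mult[OF r p(1)])
    finally show "l j (r \<odot>\<^bsub>brace_module\<^esub> x) = r \<odot>\<^bsub>module_via (\<lambda>r. r) R\<^esub> l j x"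
      by (simp add: module_via_def brace_ring_eq)
  qed
  moreover have "l j (loc_frac P (Sigma_T1 R) p s) = up_ring.coeff P p j" if "j < n" "p \<in> carrier P" for j p
    using that(1,2)
  proof (rule l_eq)
    show "\<psi> (\<sigma> \<otimes>\<^bsub>S.L\<^esub> loc_frac P (Sigma_T1 R) p s) = low_ideal n +>\<^bsub>P\<^esub> p"
      unfolding \<sigma>_def S.frac_eq_mult[OF that(2) s] by (rule \<psi>_map[OF that(2)])
  qed
  ultimately show thesis by (rule that)
qed

text \<open>Over a common denominator \<open>s\<close>, a fraction \<open>p/s\<close> is the sum of
  the \<open>X^i/s\<close> with the coefficients of \<open>p\<close>, which
  \<open>coeff_forms\<close> recovers linearly.\<close>

lemma brace_dual_system:
  assumes K: "finite K" "K \<subseteq> carrier brace_module"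
  shows "\<exists>(n::nat) b l. (\<forall>i<n. b i \<in> carrier brace_module \<and> l i \<in> linear_forms R brace_module) \<and>
    (\<forall>x\<in>K. x = (\<Oplus>\<^bsub>brace_module\<^esub>i\<in>{..<n}. l i x \<odot>\<^bsub>brace_module\<^esub> b i))"
proof -
  have "K \<subseteq> carrier S.L" using K(2) by (simp add: module_via_def brace_ring_eq)
  from S.common_denominator[OF K(1) this] obtain s where s: "s \<in> Sigma_T1 R"
    and "\<forall>x\<in>K. \<exists>p\<in>carrier P. x = loc_frac P (Sigma_T1 R) p s" by blast
  from bchoice[OF this(2)[unfolded Bex_def]] obtain num where
    num: "\<And>x. x \<in> K \<Longrightarrow> num x \<in> carrier P" "\<And>x. x \<in> K \<Longrightarrow> x = loc_frac P (Sigma_T1 R) (num x) s" by blast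
  \<comment> \<open>One degree bound for all numerators; the system then has \<open>Suc N\<close>
    members, for the exponents from \<open>0\<close> to \<open>N\<close>.\<close>
  obtain N where N: "\<And>x. x \<in> K \<Longrightarrow> deg R (num x) \<le> N"
    using finite_nat_set_iff_bounded_le[of "(\<lambda>x. deg R (num x)) ` K"] K(1) by auto
  obtain l where l: "\<And>j. j < Suc N \<Longrightarrow> l j \<in> linear_forms R brace_module"
    and l_frac: "\<And>j p. \<lbrakk>j < Suc N; p \<in> carrier P\<rbrakk> \<Longrightarrow> l j (loc_frac P (Sigma_T1 R) p s) = up_ring.coeff P p j"
    using coeff_forms[where n = "Suc N", OF s] by blast
  define b where "b i = loc_frac P (Sigma_T1 R) (up_ring.monom P \<one> i) s" for i
  have b: "b i \<in> carrier brace_module" for i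
    unfolding b_def using S.frac_closed[OF monom_closed[OF R.one_closed] s] by (simp add: module_via_def brace_ring_eq)
  have "x = (\<Oplus>\<^bsub>brace_module\<^esub>i\<in>{..<Suc N}. l i x \<odot>\<^bsub>brace_module\<^esub> b i)" if x: "x \<in> K" for x
  proof -
    interpret L: cring S.L by (rule S.cring_localization)
    define m where "m i = up_ring.monom P (up_ring.coeff P (num x) i) i" for i
    have cl: "up_ring.coeff P (num x) i \<in> carrier R" for i by (rule coeff_closed[OF num(1)[OF x]])
    have m: "m i \<in> carrier P" for i unfolding m_def by (rule monom_closed[OF cl])
    have summand: "l i x \<odot>\<^bsub>brace_module\<^esub> b i = loc_frac P (Sigma_T1 R) (m i) s" if i: "i < Suc N" for i
    proof -
      have "l i x = up_ring.coeff P (num x) i"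
        using l_frac[OF i num(1)[OF x]] num(2)[OF x] by simp
      then have "l i x \<odot>\<^bsub>brace_module\<^esub> b i = to_brace R (up_ring.coeff P (num x) i) \<otimes>\<^bsub>S.L\<^esub> b i"
        by (simp add: module_via_def brace_ring_eq)
      also have "\<dots> = loc_frac P (Sigma_T1 R) (const_poly R (up_ring.coeff P (num x) i) \<otimes>\<^bsub>P\<^esub> up_ring.monom P \<one> i) s"
        unfolding b_def to_brace_eq
        by (rule S.loc_map_mult_frac[OF const_poly_closed[OF cl] monom_closed[OF R.one_closed] s])
      also have "const_poly R (up_ring.coeff P (num x) i) \<otimes>\<^bsub>P\<^esub> up_ring.monom P \<one> i = m i"
        unfolding m_def const_poly_eq
        using monom_mult[OF cl R.one_closed, of i 0 i] R.r_one[OF cl, of i] by simp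
      finally show ?thesis .
    qed
    have "(\<Oplus>\<^bsub>brace_module\<^esub>i\<in>{..<Suc N}. l i x \<odot>\<^bsub>brace_module\<^esub> b i)
        = (\<Oplus>\<^bsub>S.L\<^esub>i\<in>{..<Suc N}. loc_frac P (Sigma_T1 R) (m i) s)"
      unfolding finsum_module_via brace_ring_eq
      using S.frac_closed[OF m s] summand unfolding brace_ring_eq by (intro L.finsum_cong') auto
    also have "\<dots> = loc_frac P (Sigma_T1 R) (\<Oplus>\<^bsub>P\<^esub>i\<in>{..<Suc N}. m i) s"
      by (rule S.finsum_frac[OF m s])
    also have "(\<Oplus>\<^bsub>P\<^esub>i\<in>{..<Suc N}. m i) = num x"
      unfolding m_def lessThan_Suc_atMost by (rule up_repr_le[OF N[OF x] num(1)[OF x]])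
    also have "loc_frac P (Sigma_T1 R) (num x) s = x" by (rule num(2)[OF x, symmetric])
    finally show ?thesis by (rule sym)
  qed
  then show ?thesis using b l by blast
qed

text \<open>The criterion for locally projective modules is applied with the unit element of
  \<open>R{X}\<close> as \<open>e\<close> and the constant coefficient as
  \<open>\<epsilon>\<close>.\<close>

theorem to_brace_faithfully_flat:
  "faithfully_flat_hom TYPE('n1) TYPE('n2) TYPE('n3) R (brace_ring R) (to_brace R)"
proof -
  have "cring R" by unfold_locales
  then have M: "module R brace_module"
    using S.cring_localization to_brace_hom unfolding brace_ring_eq by (intro module_module_via)
  \<comment> \<open>Truncation at \<open>Suc 0\<close> with denominator \<open>\<one>\<close> leaves
    only the constant-coefficient form \<open>l 0\<close>.\<close>
  obtain l where l: "\<And>j. j < Suc 0 \<Longrightarrow> l j \<in> linear_forms R brace_module"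
    and l_frac: "\<And>j p. \<lbrakk>j < Suc 0; p \<in> carrier P\<rbrakk> \<Longrightarrow> l j (loc_frac P (Sigma_T1 R) p \<one>\<^bsub>P\<^esub>) = up_ring.coeff P p j"
    using coeff_forms[where n = "Suc 0", OF S.one_S] by blast
  have e: "loc_frac P (Sigma_T1 R) \<one>\<^bsub>P\<^esub> \<one>\<^bsub>P\<^esub> \<in> carrier brace_module"
    using S.frac_closed[OF UP_one_closed S.one_S] by (simp add: module_via_def brace_ring_eq)
  have l_e: "l 0 (loc_frac P (Sigma_T1 R) \<one>\<^bsub>P\<^esub> \<one>\<^bsub>P\<^esub>) = \<one>"
    unfolding l_frac[OF lessI UP_one_closed] by simp
  show ?thesis
    unfolding faithfully_flat_hom_def
    using to_brace_hom faithfully_flat_module_if_locally_projective[OF M brace_dual_system e l[OF lessI] l_e]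
    by blast
qed

end

theorem proposition7p4:
  fixes R :: "('a, 'm) ring_scheme"
  assumes "cring R" and "\<one>\<^bsub>R\<^esub> \<noteq> \<zero>\<^bsub>R\<^esub>"
  shows "(\<forall>M. maximalideal M R \<longrightarrow>
            (\<exists>\<phi> \<in> ring_hom (brace_ring R) (slash_ring R M).
              \<forall>a \<in> carrier R. \<phi> (to_brace R a) = to_slash R M a)) \<and>
         faithfully_flat_hom TYPE('n1) TYPE('n2) TYPE('n3) R (brace_ring R) (to_brace R)"
proof -
  interpret R: UP_cring R "UP R"
    using assms(1) by (simp add: UP_cring_def)
  show ?thesis
    using R.slash_factorization R.to_brace_faithfully_flat by blast
qed

end
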